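(* Let $\mathtt B$ be a bounded set in $C_b^{\ell,\beta-\ell}(\mathbb R^{\mathsf d})$, let $\hat{\mathcal X}$ be a measurable set in $\mathbb R^{\mathsf d}$, and let $\psi:\mathbb R^{\mathsf d}\to\mathbb R$ be bounded and measurable. Suppose that the $C_b^{\ell,\beta-\ell}(\mathbb R^{\mathsf d})$-valued random variables $V_n$ ($n\in\mathbb N$) satisfy $V_n\in\mathtt B$ a.s. and $V_n\ge0$ a.s. for $n\in\mathbb N$. Let $(d_n)_{n\in\mathbb N}$ be a sequence of positive numbers with $d_n\to0$, and let $\epsilon\in(0,1]$. Let $\xi_{n,j},\xi'_{n,j}$ ($1\le j\le n$, $n\in\mathbb N$) be $\mathbb R^{\mathsf d}$-valued random variables such that $(\xi_{n,j})_{j=1,\dots,n}$ and $(\xi'_{n,j})_{j=1,\dots,n}$ have the same distribution for every $n\in\mathbb N$. Let $E_n$ and $Q_n(a)$ be as defined in the context. Then: (a) for all $n\in\mathbb N$ $$E_n\le 2C(\hat{\mathcal X},\mathtt K)\big(\sup_m\|V_m\|_\infty\big)\|\psi\|_\infty d_n^{-\mathsf d}\sup_{a\in\hat{\mathcal X}}Q_n(a)+C(\mathtt B,\mathtt K)\|\psi\|_\infty d_n^\beta+(2+\epsilon)d_n^{-\mathsf d}\|\mathtt K\|_\infty^{\mathsf d}\|\psi\|_\infty E\Big[\int_{\hat{\mathcal X}^c}V_n(a)\,da\Big],$$ where the two constants $C(\hat{\mathcal X},\mathtt K)$ and $C(\mathtt B,\mathtt K)$ are the same as those for which, without the equality-in-law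 assumption, for all $n\in\mathbb N$ $$E_n\le C(\hat{\mathcal X},\mathtt K)\big(\sup_m\|V_m\|_\infty\big)\|\psi\|_\infty d_n^{-\mathsf d}\sup_{a\in\hat{\mathcal X}}P_n(a)+C(\mathtt B,\mathtt K)\|\psi\|_\infty d_n^\beta+(2+\epsilon)d_n^{-\mathsf d}\|\mathtt K\|_\infty^{\mathsf d}\|\psi\|_\infty E\Big[\int_{\hat{\mathcal X}^c}V_n(a)\,da\Big],$$ with $P_n(a)$ as in the context; (b) if in addition $\varphi_{d_n}*V_n=V_n$ a.s., then instead of the inequality in (a) one has $$E_n\le 2C(\hat{\mathcal X},\mathtt K)\big(\sup_m\|V_m\|_\infty\big)\|\psi\|_\infty d_n^{-\mathsf d}\sup_{a\in\hat{\mathcal X}}Q_n(a)+(2+\epsilon)d_n^{-\mathsf d}\|\mathtt K\|_\infty^{\mathsf d}\|\psi\|_\infty E\Big[\int_{\hat{\mathcal X}^c}V_n(a)\,da\Big].$$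
   Context: Let $\beta>0$ and $\ell$ the largest integer with $\ell<\beta$. $C_b^{\ell,\beta-\ell}(\mathbb R^{\mathsf d})$ is the space of $\ell$-times continuously differentiable $f:\mathbb R^{\mathsf d}\to\mathbb R$ with finite norm $\sum_{i=0}^\ell\sup_x|\partial^if(x)|+\sup_{x\ne y}|\partial^\ell f(x)-\partial^\ell f(y)|/|x-y|^{\beta-\ell}$, equipped with the Borel $\sigma$-field of this norm. $\mathtt K:\mathbb R\to\mathbb R$ is a kernel function of order $\ell$ (possibly taking negative values), i.e. $\mathtt K$ is continuous and satisfies $\int|x|^s|\mathtt K(x)|dx<\infty$ for $s=0,1,\dots,\ell$, $\int\mathtt K(x)dx=1$, $\int x^s\mathtt K(x)dx=0$ for $s=1,\dots,\ell$. For $d_n>0$, $\varphi_{d_n}(x)=d_n^{-\mathsf d}\prod_{i=1}^{\mathsf d}\mathtt K(d_n^{-1}x_i)$ for $x=(x_i)\in\mathbb R^{\mathsf d}$. $\|\psi\|_\infty$ and $\|\mathtt K\|_\infty$ are sup norms; $\|V_m\|_\infty$ is the (essential) supremum of $|V_m(x)|$ over $\Omega$ and $x\in\mathbb R^{\mathsf d}$. $E_n=E\big[n^{-1}\sum_{j=1}^nV_n(\xi'_{n,j})\psi(\xi'_{n,j})\big]-(1+\epsilon)E\big[n^{-1}\sum_{j=1}^nV_n(\xi_{n,j})\psi(\xi_{n,j})\big]$. $P_n(a)=P\big[n^{-1}\sum_{j=1}^n\varphi_{d_n}(\xi'_{n,j}-a)\psi(\xi'_{n,j})-(1+\epsilon)n^{-1}\sum_{j=1}^n\varphi_{d_n}(\xi_{n,j}-a)\psi(\xi_{n,j})>0\big]$.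 $Q_n(a)=P\Big[\big|n^{-1}\sum_{j=1}^n\{\varphi_{d_n}(\xi_{n,j}-a)\psi(\xi_{n,j})-E[\varphi_{d_n}(\xi_{n,j}-a)\psi(\xi_{n,j})]\}\big|\ge\frac{\epsilon}{2(1+\epsilon)}n^{-1}\sum_{j=1}^nE[\varphi_{d_n}(\xi_{n,j}-a)\psi(\xi_{n,j})]\Big]$.
   Formalization: The constants may be infinite: C(X,K) is claimed finite only if X has finite Lebesgue measure and K is bounded, C(B,K) only if ∫|x|^β|K(x)|dx is finite (without these it fails in general); the constants are chosen for one fixed underlying set type of the probability space. *)

theory Defs
  imports "HOL-Probability.Probability" "HOL-Probability.Essential_Supremum"
begin

definition smoothness_order :: "real \<Rightarrow> nat" where
  "smoothness_order \<beta> = (GREATEST l::nat. real l < \<beta>)"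

fun iter_pd :: "'d::finite list \<Rightarrow> (real^'d \<Rightarrow> real) \<Rightarrow> real^'d \<Rightarrow> real" where
  "iter_pd [] f = f"
| "iter_pd (i # is) f = (\<lambda>x. frechet_derivative (iter_pd is f) (at x) (axis i 1))"

definition times_cont_diff :: "nat \<Rightarrow> (real^'d::finite \<Rightarrow> real) \<Rightarrow> bool" where
  "times_cont_diff k f \<longleftrightarrow>
     (\<forall>is. length is < k \<longrightarrow> (\<forall>x. iter_pd is f differentiable (at x))) \<and>
     (\<forall>is. length is \<le> k \<longrightarrow> continuous_on UNIV (iter_pd is f))"

text \<open>The \<open>k\<close>-th derivative at a point is the tensor of all partial derivatives of order
  \<open>k\<close>, with one entry for every list of \<open>k\<close> coordinate directions; its size is
  the Euclidean norm of this family of entries.\<close>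

definition hoelder_norm :: "real \<Rightarrow> (real^'d::finite \<Rightarrow> real) \<Rightarrow> ennreal" where
  "hoelder_norm \<beta> f =
     (\<Sum>i\<le>smoothness_order \<beta>. SUP x. ennreal (L2_set (\<lambda>is. iter_pd is f x) {is. length is = i}))
     + (SUP x. SUP y\<in>- {x}.
          ennreal (L2_set (\<lambda>is. iter_pd is f x - iter_pd is f y) {is. length is = smoothness_order \<beta>}
                   / norm (x - y) powr (\<beta> - real (smoothness_order \<beta>))))"

definition hoelder_space :: "real \<Rightarrow> (real^'d::finite \<Rightarrow> real) set" where
  "hoelder_space \<beta> = {f. times_cont_diff (smoothness_order \<beta>) f \<and> hoelder_norm \<beta> f < \<infinity>}"

definition hoelder_open :: "real \<Rightarrow> (real^'d::finite \<Rightarrow> real) set \<Rightarrow> bool" where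
  "hoelder_open \<beta> U \<longleftrightarrow> U \<subseteq> hoelder_space \<beta> \<and>
     (\<forall>f\<in>U. \<exists>r>0. \<forall>g\<in>hoelder_space \<beta>. hoelder_norm \<beta> (\<lambda>x. g x - f x) < ennreal r \<longrightarrow> g \<in> U)"

definition hoelder_borel :: "real \<Rightarrow> (real^'d::finite \<Rightarrow> real) measure" where
  "hoelder_borel \<beta> = sigma (hoelder_space \<beta>) {U. hoelder_open \<beta> U}"

definition hoelder_bounded :: "real \<Rightarrow> (real^'d::finite \<Rightarrow> real) set \<Rightarrow> bool" where
  "hoelder_bounded \<beta> B \<longleftrightarrow> B \<subseteq> hoelder_space \<beta> \<and> (\<exists>R::real. \<forall>f\<in>B. hoelder_norm \<beta> f \<le> ennreal R)"

text \<open>A kernel of order \<open>smoothness_order \<beta>\<close> need neither be bounded nor have a finite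
  absolute moment of the (possibly non-integer) order \<open>\<beta>\<close>. Constants that depend on the kernel
  are therefore extended nonnegative reals, with separate conditions for their finiteness.\<close>

definition kernel_of_order :: "nat \<Rightarrow> (real \<Rightarrow> real) \<Rightarrow> bool" where
  "kernel_of_order l K \<longleftrightarrow> continuous_on UNIV K \<and>
     (\<forall>s\<le>l. integrable lborel (\<lambda>x. \<bar>x\<bar> ^ s * \<bar>K x\<bar>)) \<and>
     (\<integral>x. K x \<partial>lborel) = 1 \<and>
     (\<forall>s\<in>{1..l}. (\<integral>x. x ^ s * K x \<partial>lborel) = 0)"

definition mollifier :: "(real \<Rightarrow> real) \<Rightarrow> real \<Rightarrow> real^'d::finite \<Rightarrow> real" where
  "mollifier K h x = 1 / h ^ CARD('d) * (\<Prod>i\<in>UNIV. K (x $ i / h))"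

definition convolve :: "(real^'d::finite \<Rightarrow> real) \<Rightarrow> (real^'d \<Rightarrow> real) \<Rightarrow> real^'d \<Rightarrow> real" where
  "convolve f g x = (\<integral>a. f (x - a) * g a \<partial>lborel)"

text \<open>Norms are extended nonnegative reals, because a continuous integrable kernel need not be
  bounded. In \<open>ennreal\<close> a supremum over the empty set is \<open>0\<close>, and \<open>0 * \<infinity> = 0\<close>.\<close>

definition sup_norm :: "('a \<Rightarrow> real) \<Rightarrow> ennreal" where
  "sup_norm f = (SUP x. ennreal \<bar>f x\<bar>)"

definition ess_sup_norm :: "'w measure \<Rightarrow> ('w \<Rightarrow> 'a \<Rightarrow> real) \<Rightarrow> ennreal" where
  "ess_sup_norm M V = esssup M (\<lambda>\<omega>. sup_norm (V \<omega>))"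

text \<open>Here \<open>\<xi>\<close>, \<open>\<xi>'\<close> and \<open>V\<close> stand for the data with the index \<open>n\<close> already fixed,
  and \<open>h\<close> for the bandwidth.\<close>

definition E_diff :: "'w measure \<Rightarrow> real \<Rightarrow> (real^'d::finite \<Rightarrow> real) \<Rightarrow> nat \<Rightarrow>
    ('w \<Rightarrow> real^'d \<Rightarrow> real) \<Rightarrow> (nat \<Rightarrow> 'w \<Rightarrow> real^'d) \<Rightarrow> (nat \<Rightarrow> 'w \<Rightarrow> real^'d) \<Rightarrow> real" where
  "E_diff M \<epsilon> \<psi> n V \<xi> \<xi>' =
     (\<integral>\<omega>. 1 / real n * (\<Sum>j=1..n. V \<omega> (\<xi>' j \<omega>) * \<psi> (\<xi>' j \<omega>)) \<partial>M)
     - (1 + \<epsilon>) * (\<integral>\<omega>. 1 / real n * (\<Sum>j=1..n. V \<omega> (\<xi> j \<omega>) * \<psi> (\<xi> j \<omega>)) \<partial>M)"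

definition P_exceed :: "'w measure \<Rightarrow> real \<Rightarrow> (real \<Rightarrow> real) \<Rightarrow> (real^'d::finite \<Rightarrow> real) \<Rightarrow> nat \<Rightarrow>
    real \<Rightarrow> (nat \<Rightarrow> 'w \<Rightarrow> real^'d) \<Rightarrow> (nat \<Rightarrow> 'w \<Rightarrow> real^'d) \<Rightarrow> real^'d \<Rightarrow> real" where
  "P_exceed M \<epsilon> K \<psi> n h \<xi> \<xi>' a = measure M {\<omega> \<in> space M.
     1 / real n * (\<Sum>j=1..n. mollifier K h (\<xi>' j \<omega> - a) * \<psi> (\<xi>' j \<omega>))
     - (1 + \<epsilon>) * (1 / real n) * (\<Sum>j=1..n. mollifier K h (\<xi> j \<omega> - a) * \<psi> (\<xi> j \<omega>)) > 0}"

definition Q_deviate :: "'w measure \<Rightarrow> real \<Rightarrow> (real \<Rightarrow> real) \<Rightarrow> (real^'d::finite \<Rightarrow> real) \<Rightarrow> nat \<Rightarrow>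
    real \<Rightarrow> (nat \<Rightarrow> 'w \<Rightarrow> real^'d) \<Rightarrow> real^'d \<Rightarrow> real" where
  "Q_deviate M \<epsilon> K \<psi> n h \<xi> a =
     (let m = (\<lambda>j. \<integral>\<omega>. mollifier K h (\<xi> j \<omega> - a) * \<psi> (\<xi> j \<omega>) \<partial>M) in
      measure M {\<omega> \<in> space M.
        \<bar>1 / real n * (\<Sum>j=1..n. mollifier K h (\<xi> j \<omega> - a) * \<psi> (\<xi> j \<omega>) - m j)\<bar>
        \<ge> \<epsilon> / (2 * (1 + \<epsilon>)) * (1 / real n) * (\<Sum>j=1..n. m j)})"

definition same_law :: "'w measure \<Rightarrow> nat \<Rightarrow> (nat \<Rightarrow> 'w \<Rightarrow> real^'d::finite) \<Rightarrow>
    (nat \<Rightarrow> 'w \<Rightarrow> real^'d) \<Rightarrow> bool" where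
  "same_law M n \<xi> \<xi>' \<longleftrightarrow>
     distr M (\<Pi>\<^sub>M j\<in>{1..n}. borel) (\<lambda>\<omega>. \<lambda>j\<in>{1..n}. \<xi> j \<omega>) =
     distr M (\<Pi>\<^sub>M j\<in>{1..n}. borel) (\<lambda>\<omega>. \<lambda>j\<in>{1..n}. \<xi>' j \<omega>)"

text \<open>The expected integral over the complement of \<open>X\<close>. The lower integrals ignore the negative
  part of \<open>V\<close>; the definition is used for \<open>V\<close> that are almost surely nonnegative, and the value
  may be infinite.\<close>

definition tail_mass :: "'w measure \<Rightarrow> (real^'d::finite) set \<Rightarrow> ('w \<Rightarrow> real^'d \<Rightarrow> real) \<Rightarrow> ennreal" where
  "tail_mass M X V = (\<integral>\<^sup>+\<omega>. (\<integral>\<^sup>+a\<in>- X. ennreal (V \<omega> a) \<partial>lborel) \<partial>M)"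

end

theory Submission
  imports Defs
begin

text \<open>Write \<open>V = \<phi> * V + r\<close> with the mollifier \<open>\<phi>\<close>. The order of the kernel makes \<open>r\<close> of size
  \<open>d\<^sup>\<beta>\<close> (one Taylor expansion per coordinate). The remaining part is
  \<open>\<integral> V(a) D(a) da\<close>, where \<open>D(a)\<close> is the random variable whose positivity defines the event of
  \<open>P_exceed\<close>; so over \<open>X\<close> only the event \<open>D(a) > 0\<close> contributes, and over the complement
  the sup norm of \<open>D\<close> is integrated against \<open>V\<close>. Under equality in law both empirical means have
  the same expectation \<open>T\<close>, and \<open>D(a) > 0\<close> forces one of them to deviate from \<open>T\<close> by at least
  \<open>\<epsilon> T / (2 (1 + \<epsilon>))\<close>.\<close>

text \<open>The norms, the constants and the tail integral may be infinite, while the left-hand side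
  is a signed real. The estimates therefore take place in \<open>ennreal\<close>, where a negative
  real counts as 0. This loses nothing, since the right-hand sides are nonnegative, and it discards
  the set \<open>D(a) \<le> 0\<close> automatically. All three inequalities must share their
  constants. So one estimate, \<open>E_diff_le\<close>, is proved with free bounds
  \<open>\<delta>\<close> for the remainder \<open>r\<close>, \<open>v\<close> for the sup norm of
  \<open>V\<close> and \<open>p\<close> for the exceedance probabilities. Part (b) is the case
  \<open>\<delta> = 0\<close>; equality in law gives \<open>p\<close> as twice the supremum of
  \<open>Q_deviate\<close>. The constant for \<open>B\<close> is built from the supremum of the very
  quotient it has to bound, so the inequality holds even where that supremum is infinite; the
  absolute moment of order \<open>\<beta>\<close> enters through its finiteness. The factor 3 in
  both constants bounds \<open>2 + \<epsilon>\<close>; the constant for \<open>X\<close> also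
  collects the volume of \<open>X\<close> and the sup norm of the product kernel. Exchanging the
  integrals over \<open>a\<close> and \<open>\<omega>\<close> needs joint measurability of
  \<open>V\<close>, which is given only as a random element of a function space.\<close>

section \<open>Joint measurability of random Hoelder functions\<close>

lemma borel_measurable_caratheodory:
  fixes f :: "'w \<Rightarrow> 'a::{second_countable_topology, metric_space} \<Rightarrow> real"
  assumes meas: "\<And>x. (\<lambda>\<omega>. f \<omega> x) \<in> borel_measurable M"
    and cont: "\<And>\<omega>. \<omega> \<in> space M \<Longrightarrow> continuous_on UNIV (f \<omega>)"
  shows "(\<lambda>p. f (fst p) (snd p)) \<in> borel_measurable (M \<Otimes>\<^sub>M borel)"
proof -
  \<comment> \<open>The identity is a pointwise limit of simple functions \<open>F i\<close>. With
    \<open>F i\<close> in the second argument only finitely many sections of \<open>f\<close> occur,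
    each measurable in \<open>\<omega>\<close>; continuity of \<open>f \<omega>\<close> passes to
    the limit.\<close>
  have "(\<lambda>x::'a. x) \<in> borel_measurable borel" by simp
  from borel_measurable_implies_sequence_metric[OF this, of undefined]
  obtain F where F: "\<And>i. simple_function borel (F i)" "\<And>x::'a. (\<lambda>i. F i x) \<longlonglongrightarrow> x"
    by auto
  have "(\<lambda>p. f (fst p) (F i (snd p))) \<in> borel_measurable (M \<Otimes>\<^sub>M borel)" for i
  proof (rule measurable_compose_countable'[where I = "range (F i)" and f = "\<lambda>y p. f (fst p) y"])
    show "countable (range (F i))"
      using simple_functionD(1)[OF F(1), of i] by (simp add: countable_finite)
    have "F i \<in> borel \<rightarrow>\<^sub>M count_space (range (F i))"
      using F(1)[of i] unfolding simple_function_def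
      by (subst measurable_count_space_eq2) auto
    then show "(\<lambda>p. F i (snd p)) \<in> M \<Otimes>\<^sub>M borel \<rightarrow>\<^sub>M count_space (range (F i))"
      by (rule measurable_compose[OF measurable_snd])
  qed (use meas in measurable)
  moreover have "(\<lambda>i. f (fst p) (F i (snd p))) \<longlonglongrightarrow> f (fst p) (snd p)"
    if "p \<in> space (M \<Otimes>\<^sub>M borel)" for p
    using that by (intro continuous_on_tendsto_compose[OF cont F(2)]) (auto simp: space_pair_measure)
  ultimately show ?thesis
    by (rule borel_measurable_LIMSEQ_metric)
qed

lemma smoothness_order_less:
  assumes "\<beta> > 0"
  shows "real (smoothness_order \<beta>) < \<beta>"
  unfolding smoothness_order_def
proof (rule GreatestI_nat[where k = 0 and b = "nat \<lceil>\<beta>\<rceil>"])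
  show "y \<le> nat \<lceil>\<beta>\<rceil>" if "real y < \<beta>" for y
    using that by linarith
qed (use assms in simp)

text \<open>The only partial derivative of order 0 is the function itself, so the first summand of
  the norm is its sup norm. This is what makes evaluation at a point continuous on the Hoelder
  space.\<close>

lemma abs_le_hoelder_norm: "ennreal \<bar>f x\<bar> \<le> hoelder_norm \<beta> f"
proof -
  let ?S = "\<lambda>i. SUP x. ennreal (L2_set (\<lambda>is. iter_pd is f x) {is. length is = i})"
  have "{is :: 'a list. length is = 0} = {[]}" by auto
  then have "ennreal \<bar>f x\<bar> = ennreal (L2_set (\<lambda>is. iter_pd is f x) {is. length is = 0})"
    by (simp add: L2_set_def)
  also have "\<dots> \<le> ?S 0" by (rule SUP_upper) simp
  also have "\<dots> \<le> (\<Sum>i\<le>smoothness_order \<beta>. ?S i)"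
    by (rule member_le_sum) auto
  also have "\<dots> \<le> hoelder_norm \<beta> f" unfolding hoelder_norm_def by simp
  finally show ?thesis .
qed

text \<open>The Hoelder quotient involves the Euclidean norm of the whole tensor of top order, which
  dominates each single entry.\<close>

lemma iter_pd_hoelder:
  fixes f :: "real^'d::finite \<Rightarrow> real"
  assumes R: "hoelder_norm \<beta> f \<le> ennreal R" "R \<ge> 0" and len: "length is = smoothness_order \<beta>"
  shows "\<bar>iter_pd is f x - iter_pd is f y\<bar> \<le> R * norm (x - y) powr (\<beta> - real (smoothness_order \<beta>))"
proof (cases "x = y")
  case False
  let ?L = "L2_set (\<lambda>is. iter_pd is f x - iter_pd is f y) {is. length is = smoothness_order \<beta>}"
  let ?p = "norm (x - y) powr (\<beta> - real (smoothness_order \<beta>))"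
  have fin: "finite {is :: 'd list. length is = smoothness_order \<beta>}"
    using finite_lists_length_eq[of "UNIV :: 'd set" "smoothness_order \<beta>"] by simp
  have "ennreal (?L / ?p) \<le> (SUP x. SUP y\<in>- {x}.
      ennreal (L2_set (\<lambda>is. iter_pd is f x - iter_pd is f y) {is. length is = smoothness_order \<beta>}
        / norm (x - y) powr (\<beta> - real (smoothness_order \<beta>))))"
    by (rule SUP_upper2[of x], simp, rule SUP_upper2[of y]) (use False in auto)
  also have "\<dots> \<le> ennreal R"
    using R(1) unfolding hoelder_norm_def by (rule order.trans[rotated]) simp
  finally have "?L / ?p \<le> R" using R(2) by (simp add: ennreal_le_iff)
  then have "?L \<le> R * ?p" using False by (simp add: field_simps)
  moreover have "\<bar>iter_pd is f x - iter_pd is f y\<bar> \<le> ?L"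
    using member_le_L2_set[OF fin, of "is" "\<lambda>is. \<bar>iter_pd is f x - iter_pd is f y\<bar>"] len
    by (simp add: L2_set_def)
  ultimately show ?thesis by simp
qed simp

lemma hoelder_space_continuous: "f \<in> hoelder_space \<beta> \<Longrightarrow> continuous_on UNIV f"
  unfolding hoelder_space_def times_cont_diff_def by (auto dest!: spec[of _ "[]"])

lemma space_hoelder_borel: "space (hoelder_borel \<beta>) = hoelder_space \<beta>"
  unfolding hoelder_borel_def by (rule space_measure_of) (auto simp: hoelder_open_def)

text \<open>Evaluation changes by at most the norm of the increment, so around \<open>f\<close> the
  superlevel set contains the ball of radius \<open>f x - c\<close>.\<close>

lemma measurable_eval_hoelder_borel:
  fixes x :: "real^'d::finite"
  shows "(\<lambda>f. f x) \<in> borel_measurable (hoelder_borel \<beta>)"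
proof (rule borel_measurableI_greater)
  fix c
  have "hoelder_open \<beta> {f \<in> hoelder_space \<beta>. c < f x}"
    unfolding hoelder_open_def
  proof (intro conjI ballI)
    fix f assume f: "f \<in> {f \<in> hoelder_space \<beta>. c < f x}"
    show "\<exists>r>0. \<forall>g\<in>hoelder_space \<beta>. hoelder_norm \<beta> (\<lambda>x. g x - f x) < ennreal r
        \<longrightarrow> g \<in> {f \<in> hoelder_space \<beta>. c < f x}"
    proof (intro exI[of _ "f x - c"] conjI ballI impI)
      fix g assume g: "g \<in> hoelder_space \<beta>" "hoelder_norm \<beta> (\<lambda>x. g x - f x) < ennreal (f x - c)"
      then have "ennreal \<bar>g x - f x\<bar> < ennreal (f x - c)"
        using abs_le_hoelder_norm[of "\<lambda>x. g x - f x" x \<beta>] by simp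
      then have "\<bar>g x - f x\<bar> < f x - c" by (simp add: ennreal_less_iff)
      then show "g \<in> {f \<in> hoelder_space \<beta>. c < f x}" using g by auto
    qed (use f in simp)
  qed auto
  then have "{f \<in> hoelder_space \<beta>. c < f x} \<in> sets (hoelder_borel \<beta>)"
    unfolding hoelder_borel_def by (subst sets_measure_of) (auto simp: hoelder_open_def)
  then show "{f \<in> space (hoelder_borel \<beta>). c < f x} \<in> sets (hoelder_borel \<beta>)"
    by (simp add: space_hoelder_borel)
qed

text \<open>Needed for Fubini and for \<open>V \<omega> (\<xi> j \<omega>)\<close> to be a random
  variable. Joint continuity of evaluation is no shortcut: the Hoelder space is not separable, and
  open sets of a product with it need not belong to the product sigma-field. Evaluations at fixed
  points and continuity of every path suffice.\<close>

lemma hoelder_borel_jointly_measurable: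
  fixes V :: "'w \<Rightarrow> real^'d::finite \<Rightarrow> real"
  assumes V: "V \<in> measurable M (hoelder_borel \<beta>)"
  shows "(\<lambda>p. V (fst p) (snd p)) \<in> borel_measurable (M \<Otimes>\<^sub>M borel)"
proof (rule borel_measurable_caratheodory)
  show "(\<lambda>\<omega>. V \<omega> x) \<in> borel_measurable M" for x
    by (rule measurable_compose[OF V measurable_eval_hoelder_borel])
  show "continuous_on UNIV (V \<omega>)" if "\<omega> \<in> space M" for \<omega>
    using measurable_space[OF V that] by (intro hoelder_space_continuous) (simp add: space_hoelder_borel)
qed

section \<open>The smoothing error of the product kernel\<close>

text \<open>In the Lagrange remainder the derivative of top order sits at an intermediate
  \<open>s\<close> with \<open>\<bar>s\<bar> \<le> \<bar>t\<bar>\<close>; moving it to 0 is paid for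
  by the Hoelder condition. Only pure derivatives in direction \<open>i\<close> occur, which is
  enough because a product kernel can be integrated one coordinate at a time.\<close>

lemma coordinate_taylor:
  fixes f :: "real^'d::finite \<Rightarrow> real" and i :: 'd
  assumes \<beta>: "\<beta> > 0" and f: "f \<in> hoelder_space \<beta>"
    and R: "hoelder_norm \<beta> f \<le> ennreal R" "R \<ge> 0"
  shows "\<bar>f (z + t *\<^sub>R axis i 1)
      - (\<Sum>k\<le>smoothness_order \<beta>. iter_pd (replicate k i) f z / fact k * t ^ k)\<bar> \<le> R * \<bar>t\<bar> powr \<beta>"
proof -
  let ?l = "smoothness_order \<beta>" and ?e = "axis i 1 :: real^'d"
  define g where "g k t = iter_pd (replicate k i) f (z + t *\<^sub>R ?e)" for k t
  have deriv: "(g k has_real_derivative g (Suc k) t) (at t)" if "k < ?l" for k t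
  proof -
    let ?F = "iter_pd (replicate k i) f"
    have "?F differentiable (at (z + t *\<^sub>R ?e))"
      using f that unfolding hoelder_space_def times_cont_diff_def by simp
    then have D: "(?F has_derivative frechet_derivative ?F (at (z + t *\<^sub>R ?e))) (at (z + t *\<^sub>R ?e))"
      by (simp add: frechet_derivative_works)
    have "((\<lambda>t. ?F (z + t *\<^sub>R ?e)) has_derivative
        (\<lambda>s. frechet_derivative ?F (at (z + t *\<^sub>R ?e)) (s *\<^sub>R ?e))) (at t)"
      by (rule has_derivative_compose[where f = "\<lambda>t. z + t *\<^sub>R ?e", OF _ D]) (auto intro!: derivative_eq_intros)
    moreover have "frechet_derivative ?F (at (z + t *\<^sub>R ?e)) (s *\<^sub>R ?e) = g (Suc k) t * s" for s
      using linear_scale[OF has_derivative_linear[OF D]] by (simp add: g_def mult.commute)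
    ultimately show ?thesis
      by (simp add: has_field_derivative_def g_def[abs_def])
  qed
  \<comment> \<open>Valid for \<open>t\<close> of either sign; for \<open>?l = 0\<close> the sum is
    empty and the claim is \<open>g 0 t = g 0 s\<close>.\<close>
  have "\<exists>s. \<bar>s\<bar> \<le> \<bar>t\<bar> \<and> g 0 t = (\<Sum>m<?l. g m 0 / fact m * t ^ m) + g ?l s / fact ?l * t ^ ?l"
    using Maclaurin_bi_le[of g "g 0" ?l t] deriv by blast
  then obtain s where s: "\<bar>s\<bar> \<le> \<bar>t\<bar>"
    and T: "g 0 t = (\<Sum>m<?l. g m 0 / fact m * t ^ m) + g ?l s / fact ?l * t ^ ?l" by blast
  have less: "real ?l < \<beta>" by (rule smoothness_order_less[OF \<beta>])
  have "\<bar>g ?l s - g ?l 0\<bar> \<le> R * norm (s *\<^sub>R ?e) powr (\<beta> - real ?l)"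
    using iter_pd_hoelder[OF R, of "replicate ?l i" "z + s *\<^sub>R ?e" z] by (simp add: g_def)
  also have "\<dots> \<le> R * \<bar>t\<bar> powr (\<beta> - real ?l)"
    using s less R(2) by (intro mult_left_mono powr_mono2) (auto simp: norm_axis_1)
  finally have H: "\<bar>g ?l s - g ?l 0\<bar> \<le> R * \<bar>t\<bar> powr (\<beta> - real ?l)" .
  have "f (z + t *\<^sub>R ?e) - (\<Sum>k\<le>?l. iter_pd (replicate k i) f z / fact k * t ^ k)
      = (g ?l s - g ?l 0) / fact ?l * t ^ ?l"
    using T by (simp add: g_def lessThan_Suc_atMost[symmetric] algebra_simps diff_divide_distrib)
  also have "\<bar>\<dots>\<bar> = \<bar>g ?l s - g ?l 0\<bar> / fact ?l * \<bar>t\<bar> ^ ?l"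
    by (simp add: abs_mult power_abs)
  also have "\<dots> \<le> \<bar>g ?l s - g ?l 0\<bar> * \<bar>t\<bar> ^ ?l"
    using mult_right_mono[OF fact_ge_1[of ?l, where 'a = real], of "\<bar>g ?l s - g ?l 0\<bar>"]
    by (intro mult_right_mono) (auto simp: field_simps)
  also have "\<dots> \<le> R * \<bar>t\<bar> powr (\<beta> - real ?l) * \<bar>t\<bar> ^ ?l"
    by (intro mult_right_mono H) auto
  \<comment> \<open>At \<open>t = 0\<close> both sides vanish since \<open>0 powr x = 0\<close>,
    even if \<open>?l = 0\<close> and \<open>t ^ ?l = 1\<close>.\<close>
  also have "\<dots> = R * \<bar>t\<bar> powr \<beta>"
    by (cases "t = 0") (simp_all add: powr_realpow[symmetric] powr_add[symmetric] mult.assoc)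
  finally show ?thesis .
qed

lemma hoelder_bounded_sup:
  assumes "hoelder_norm \<beta> f \<le> ennreal R" "R \<ge> 0"
  shows "\<bar>f x\<bar> \<le> R"
  using order.trans[OF abs_le_hoelder_norm assms(1)] assms(2) by (simp add: ennreal_le_iff)

lemma kernel_of_orderD:
  assumes "kernel_of_order l K"
  shows "K \<in> borel_measurable borel" "integrable lborel K" "(\<integral>x. K x \<partial>lborel) = 1"
    "s \<le> l \<Longrightarrow> integrable lborel (\<lambda>x. x ^ s * K x)"
    "1 \<le> s \<Longrightarrow> s \<le> l \<Longrightarrow> (\<integral>x. x ^ s * K x \<partial>lborel) = 0"
proof -
  show K: "K \<in> borel_measurable borel"
    using assms unfolding kernel_of_order_def by (auto intro: borel_measurable_continuous_onI)
  show *: "integrable lborel (\<lambda>x. x ^ s * K x)" if "s \<le> l" for s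
  proof (rule Bochner_Integration.integrable_bound)
    show "integrable lborel (\<lambda>x. \<bar>x\<bar> ^ s * \<bar>K x\<bar>)"
      using assms that unfolding kernel_of_order_def by auto
  qed (use K in \<open>auto simp: abs_mult power_abs\<close>)
  show "integrable lborel K" using *[of 0] by simp
qed (use assms in \<open>auto simp: kernel_of_order_def\<close>)

text \<open>Integrated against \<open>K\<close>, the Taylor polynomial reduces to its constant term
  \<open>f z\<close>, because \<open>K\<close> has integral 1 and its moments of orders 1 to
  \<open>smoothness_order \<beta>\<close> vanish. The remainder is at most
  \<open>R * (h * \<bar>t\<bar>) powr \<beta>\<close>, whence the rate \<open>h powr \<beta>\<close>
  and the absolute moment of order \<open>\<beta>\<close>.\<close>

lemma coordinate_smoothing_error:
  fixes f :: "real^'d::finite \<Rightarrow> real" and i :: 'd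
  assumes \<beta>: "\<beta> > 0" and f: "f \<in> hoelder_space \<beta>"
    and R: "hoelder_norm \<beta> f \<le> ennreal R" "R \<ge> 0"
    and K: "kernel_of_order (smoothness_order \<beta>) K"
    and mom: "integrable lborel (\<lambda>t. \<bar>t\<bar> powr \<beta> * \<bar>K t\<bar>)" and h: "h > 0"
  shows "\<bar>(\<integral>t. K t * f (z - (h * t) *\<^sub>R axis i 1) \<partial>lborel) - f z\<bar>
    \<le> R * h powr \<beta> * (\<integral>t. \<bar>t\<bar> powr \<beta> * \<bar>K t\<bar> \<partial>lborel)"
proof -
  let ?l = "smoothness_order \<beta>"
  \<comment> \<open>The power of \<open>- h\<close> reflects the shift by \<open>- (h * t)\<close>
    in a convolution.\<close>
  define c where "c k = iter_pd (replicate k i) f z / fact k * (- h) ^ k" for k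
  define \<rho> where "\<rho> t = f (z - (h * t) *\<^sub>R axis i 1) - (\<Sum>k\<le>?l. c k * t ^ k)" for t
  note [measurable] = kernel_of_orderD(1)[OF K]
  have cf: "continuous_on UNIV f" by (rule hoelder_space_continuous[OF f])
  then have [measurable]: "f \<in> borel_measurable borel" by (rule borel_measurable_continuous_onI)
  have \<rho>: "\<bar>\<rho> t\<bar> \<le> R * h powr \<beta> * \<bar>t\<bar> powr \<beta>" for t
  proof -
    have "(- (h * t)) ^ k = (- h) ^ k * t ^ k" for k
      by (metis minus_mult_left power_mult_distrib)
    then show ?thesis
      using coordinate_taylor[OF \<beta> f R, of z "- (h * t)" i] h
      by (simp add: \<rho>_def c_def abs_mult powr_mult mult.assoc)
  qed
  have intf: "integrable lborel (\<lambda>t. K t * f (z - (h * t) *\<^sub>R axis i 1))"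
  proof (rule Bochner_Integration.integrable_bound)
    show "integrable lborel (\<lambda>t. R * K t)"
      using kernel_of_orderD(2)[OF K] by simp
    show "AE t in lborel. norm (K t * f (z - (h * t) *\<^sub>R axis i 1)) \<le> norm (R * K t)"
      using hoelder_bounded_sup[OF R] R(2)
      by (auto simp: abs_mult mult.commute[of R] intro!: mult_left_mono)
  qed simp
  have intP: "integrable lborel (\<lambda>t. \<Sum>k\<le>?l. c k * (t ^ k * K t))"
    using kernel_of_orderD(4)[OF K] by auto
  have "(\<integral>t. (\<Sum>k\<le>?l. c k * (t ^ k * K t)) \<partial>lborel) = (\<Sum>k\<le>?l. c k * (\<integral>t. t ^ k * K t \<partial>lborel))"
    using kernel_of_orderD(4)[OF K] by (simp add: Bochner_Integration.integral_sum)
  also have "\<dots> = (\<Sum>k\<le>?l. if k = 0 then c 0 else 0)"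
    using kernel_of_orderD(3,5)[OF K] by (intro sum.cong) auto
  also have "\<dots> = f z" by (simp add: c_def)
  finally have P: "(\<integral>t. (\<Sum>k\<le>?l. c k * (t ^ k * K t)) \<partial>lborel) = f z" .
  have "(\<integral>t. K t * f (z - (h * t) *\<^sub>R axis i 1) \<partial>lborel) - f z
      = (\<integral>t. K t * f (z - (h * t) *\<^sub>R axis i 1) - (\<Sum>k\<le>?l. c k * (t ^ k * K t)) \<partial>lborel)"
    by (simp add: Bochner_Integration.integral_diff[OF intf intP] P)
  also have "\<dots> = (\<integral>t. K t * \<rho> t \<partial>lborel)"
    by (intro Bochner_Integration.integral_cong)
       (auto simp: \<rho>_def right_diff_distrib sum_distrib_left mult_ac)
  also have "\<bar>\<dots>\<bar> \<le> (\<integral>t. \<bar>K t * \<rho> t\<bar> \<partial>lborel)" by (rule integral_abs_bound)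
  also have "\<dots> \<le> (\<integral>t. R * h powr \<beta> * (\<bar>t\<bar> powr \<beta> * \<bar>K t\<bar>) \<partial>lborel)"
  proof (rule integral_mono')
    show "\<bar>K t * \<rho> t\<bar> \<le> R * h powr \<beta> * (\<bar>t\<bar> powr \<beta> * \<bar>K t\<bar>)" for t
      using mult_right_mono[OF \<rho>[of t], of "\<bar>K t\<bar>"] by (simp add: abs_mult mult_ac)
  qed (use mom R(2) in auto)
  finally show ?thesis by simp
qed

text \<open>Integrating out one coordinate turns \<open>f\<close> into \<open>f\<close> plus an error of size at most \<open>e\<close>, so the errors of
  the coordinates add up, up to powers of the \<open>L\<^sup>1\<close> norm of the kernel.\<close>

lemma product_smoothing_error:
  fixes f :: "'a::euclidean_space \<Rightarrow> real"
  assumes K: "integrable lborel K" and f: "f \<in> borel_measurable borel" "\<And>x. \<bar>f x\<bar> \<le> R"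
    and step: "\<And>b z. b \<in> Basis \<Longrightarrow> \<bar>(\<integral>t. K t * f (z - (h * t) *\<^sub>R b) \<partial>lborel) - f z\<bar> \<le> e"
    and e: "e \<ge> 0" and I: "I \<subseteq> Basis"
  shows "\<bar>(\<integral>y. (\<Prod>b\<in>I. K (y b)) * f (x - (\<Sum>b\<in>I. (h * y b) *\<^sub>R b)) \<partial>(\<Pi>\<^sub>M b\<in>I. lborel)) - f x\<bar>
    \<le> real (card I) * max 1 (\<integral>t. \<bar>K t\<bar> \<partial>lborel) ^ card I * e"
proof -
  let ?m = "max 1 (\<integral>t. \<bar>K t\<bar> \<partial>lborel)"
  interpret product_sigma_finite "\<lambda>_::'a. lborel :: real measure" ..
  have "finite I" using I finite_Basis by (rule finite_subset)
  then show ?thesis using I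
  proof (induction I)
    case empty
    show ?case using e by (simp add: PiM_empty lebesgue_integral_count_space_finite)
  next
    case (insert b I)
    note [measurable] = f(1) and Km[measurable] = borel_measurable_integrable[OF K]
    let ?g = "\<lambda>I y. (\<Prod>b\<in>I. K (y b)) * f (x - (\<Sum>b\<in>I. (h * y b) *\<^sub>R b))"
    \<comment> \<open>A bounded factor keeps the product kernel integrable. This serves the
      integrand over \<open>I\<close>, the one over \<open>insert b I\<close> and the error
      term.\<close>
    have int: "integrable (\<Pi>\<^sub>M b\<in>J. lborel) (\<lambda>y. (\<Prod>b\<in>J. K (y b)) * g y)"
      if "finite J" "g \<in> borel_measurable (\<Pi>\<^sub>M b\<in>J. lborel)" "\<And>y. \<bar>g y\<bar> \<le> c" for J c and g :: "('a \<Rightarrow> real) \<Rightarrow> real"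
    proof (rule Bochner_Integration.integrable_bound)
      show "integrable (\<Pi>\<^sub>M b\<in>J. lborel) (\<lambda>y. c * (\<Prod>b\<in>J. K (y b)))"
        using product_integrable_prod[OF that(1), of "\<lambda>_. K"] K by simp
      have "\<bar>g y\<bar> \<le> \<bar>c\<bar>" for y using that(3)[of y] by linarith
      then show "AE y in \<Pi>\<^sub>M b\<in>J. lborel. norm ((\<Prod>b\<in>J. K (y b)) * g y) \<le> norm (c * (\<Prod>b\<in>J. K (y b)))"
        by (auto simp: abs_mult mult.commute[of "\<bar>c\<bar>"] intro!: mult_left_mono)
    qed (use that in measurable)
    have gm: "(\<lambda>y. f (x - (\<Sum>b\<in>J. (h * y b) *\<^sub>R b))) \<in> borel_measurable (\<Pi>\<^sub>M b\<in>J. lborel)"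
      if "finite J" for J by measurable
    \<comment> \<open>The error of integrating out coordinate \<open>b\<close> alone. Since
      \<open>step\<close> bounds it uniformly by \<open>e\<close>, the remaining coordinates only
      contribute powers of the integral of \<open>\<bar>K t\<bar>\<close>.\<close>
    define A where "A z = (\<integral>t. K t * f (z - (h * t) *\<^sub>R b) \<partial>lborel) - f z" for z
    have Ae: "\<bar>A z\<bar> \<le> e" for z using step insert.prems by (simp add: A_def)
    have [measurable]: "A \<in> borel_measurable borel"
      unfolding A_def by measurable
    let ?X = "\<lambda>y. x - (\<Sum>b\<in>I. (h * y b) *\<^sub>R b)"
    have intA: "integrable (\<Pi>\<^sub>M b\<in>I. lborel) (\<lambda>y. (\<Prod>b\<in>I. K (y b)) * A (?X y))"
      by (rule int[OF _ _ Ae]) (use insert.hyps in measurable)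
    have intI: "integrable (\<Pi>\<^sub>M b\<in>I. lborel) (?g I)"
      by (rule int[OF _ gm f(2)]) fact+
    have "integral\<^sup>L (\<Pi>\<^sub>M b\<in>insert b I. lborel) (?g (insert b I))
        = (\<integral>y. (\<integral>t. ?g (insert b I) (y(b := t)) \<partial>lborel) \<partial>(\<Pi>\<^sub>M b\<in>I. lborel))"
      using insert.hyps by (intro product_integral_insert int[OF _ gm f(2)]) auto
    also have "\<dots> = (\<integral>y. ?g I y + (\<Prod>b\<in>I. K (y b)) * A (?X y) \<partial>(\<Pi>\<^sub>M b\<in>I. lborel))"
    proof (intro Bochner_Integration.integral_cong refl)
      fix y :: "'a \<Rightarrow> real"
      have ne: "b' \<noteq> b" if "b' \<in> I" for b' using that insert.hyps by auto
      have "?g (insert b I) (y(b := t)) = (\<Prod>b\<in>I. K (y b)) * (K t * f (?X y - (h * t) *\<^sub>R b))" for t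
        using insert.hyps by (simp add: ne algebra_simps cong: prod.cong sum.cong)
      then have "(\<integral>t. ?g (insert b I) (y(b := t)) \<partial>lborel)
          = (\<Prod>b\<in>I. K (y b)) * (\<integral>t. K t * f (?X y - (h * t) *\<^sub>R b) \<partial>lborel)"
        by (simp only: integral_mult_right_zero)
      then show "(\<integral>t. ?g (insert b I) (y(b := t)) \<partial>lborel) = ?g I y + (\<Prod>b\<in>I. K (y b)) * A (?X y)"
        by (simp only: A_def right_diff_distrib)
    qed
    also have "\<dots> = integral\<^sup>L (\<Pi>\<^sub>M b\<in>I. lborel) (?g I) + (\<integral>y. (\<Prod>b\<in>I. K (y b)) * A (?X y) \<partial>(\<Pi>\<^sub>M b\<in>I. lborel))"
      by (rule Bochner_Integration.integral_add[OF intI intA])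
    finally have eq: "integral\<^sup>L (\<Pi>\<^sub>M b\<in>insert b I. lborel) (?g (insert b I)) = \<dots>" .
    have "\<bar>\<integral>y. (\<Prod>b\<in>I. K (y b)) * A (?X y) \<partial>(\<Pi>\<^sub>M b\<in>I. lborel)\<bar>
        \<le> (\<integral>y. \<bar>(\<Prod>b\<in>I. K (y b)) * A (?X y)\<bar> \<partial>(\<Pi>\<^sub>M b\<in>I. lborel))"
      by (rule integral_abs_bound)
    also have "\<dots> \<le> (\<integral>y. (\<Prod>b\<in>I. \<bar>K (y b)\<bar>) * e \<partial>(\<Pi>\<^sub>M b\<in>I. lborel))"
    proof (rule integral_mono')
      show "integrable (\<Pi>\<^sub>M b\<in>I. lborel) (\<lambda>y. (\<Prod>b\<in>I. \<bar>K (y b)\<bar>) * e)"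
        using product_integrable_prod[OF insert.hyps(1), of "\<lambda>_ t. \<bar>K t\<bar>"] K by simp
    qed (use Ae e in \<open>auto simp: abs_mult abs_prod intro!: mult_left_mono mult_nonneg_nonneg prod_nonneg\<close>)
    also have "\<dots> = (\<integral>t. \<bar>K t\<bar> \<partial>lborel) ^ card I * e"
      using product_integral_prod[OF insert.hyps(1), of "\<lambda>_ t. \<bar>K t\<bar>"] K by simp
    also have "\<dots> \<le> ?m ^ card I * e"
      using e by (intro mult_right_mono power_mono) auto
    finally have 1: "\<bar>\<integral>y. (\<Prod>b\<in>I. K (y b)) * A (?X y) \<partial>(\<Pi>\<^sub>M b\<in>I. lborel)\<bar> \<le> ?m ^ card I * e" .
    have "\<bar>integral\<^sup>L (\<Pi>\<^sub>M b\<in>insert b I. lborel) (?g (insert b I)) - f x\<bar>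
        \<le> real (card I) * ?m ^ card I * e + ?m ^ card I * e"
      using eq 1 insert.IH insert.prems by simp
    also have "\<dots> = real (card (insert b I)) * ?m ^ card I * e"
      using insert.hyps by (simp add: algebra_simps)
    \<comment> \<open>The maximum with 1 makes the powers of \<open>?m\<close> increase with the
      exponent.\<close>
    also have "\<dots> \<le> real (card (insert b I)) * ?m ^ card (insert b I) * e"
      using insert.hyps e by (intro mult_right_mono mult_left_mono power_increasing) auto
    finally show ?case .
  qed
qed

lemma
  fixes F :: "'a::euclidean_space \<Rightarrow> real"
  assumes c: "c \<noteq> 0" and [measurable]: "F \<in> borel_measurable borel"
  shows integral_lborel_affine:
      "integral\<^sup>L lborel F = \<bar>c\<bar> ^ DIM('a) * (\<integral>y. F (t + c *\<^sub>R y) \<partial>lborel)"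
    and integrable_lborel_affine_iff:
      "integrable lborel F \<longleftrightarrow> integrable lborel (\<lambda>y. F (t + c *\<^sub>R y))"
proof -
  have eq: "lborel = density (distr lborel borel (\<lambda>y. t + c *\<^sub>R y)) (\<lambda>_. ennreal (\<bar>c\<bar> ^ DIM('a)))"
    using lborel_affine[OF c, of t] by simp
  show "integral\<^sup>L lborel F = \<bar>c\<bar> ^ DIM('a) * (\<integral>y. F (t + c *\<^sub>R y) \<partial>lborel)"
    by (subst eq) (simp add: integral_density integral_distr)
  show "integrable lborel F \<longleftrightarrow> integrable lborel (\<lambda>y. F (t + c *\<^sub>R y))"
    using c by (subst eq) (simp add: integrable_density integrable_distr_eq)
qed

text \<open>\<open>lborel_eq\<close> assembles Lebesgue measure from coordinates indexed by
  \<open>Basis\<close>, so the product over the index type is rewritten over that set.\<close>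

lemma mollifier_scaleR:
  assumes "h > 0"
  shows "mollifier K h (h *\<^sub>R y :: real^'d::finite) = 1 / h ^ CARD('d) * (\<Prod>b\<in>Basis. K (y \<bullet> b))"
proof -
  have inj: "inj (\<lambda>i. axis i 1 :: real^'d)" by (auto simp: inj_on_def axis_eq_axis)
  have B: "(Basis :: (real^'d) set) = range (\<lambda>i. axis i 1)" by (auto simp: Basis_vec_def)
  show ?thesis
    using assms by (simp add: B mollifier_def prod.reindex[OF inj] inner_axis)
qed

lemma borel_measurable_mollifier [measurable]:
  assumes [measurable]: "K \<in> borel_measurable borel"
  shows "(mollifier K h :: real^'d::finite \<Rightarrow> real) \<in> borel_measurable borel"
proof -
  have [measurable]: "(\<lambda>x :: real^'d. x $ i) \<in> borel_measurable borel" for i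
    by (intro borel_measurable_continuous_onI continuous_intros)
  show ?thesis unfolding mollifier_def[abs_def] by measurable
qed

lemma integrable_mollifier:
  assumes K: "integrable lborel K" and h: "h > 0"
  shows "integrable lborel (\<lambda>a :: real^'d::finite. mollifier K h (x - a))"
proof -
  interpret product_sigma_finite "\<lambda>_::real^'d. lborel :: real measure" ..
  have [measurable]: "K \<in> borel_measurable borel" using borel_measurable_integrable[OF K] by simp
  have "integrable (\<Pi>\<^sub>M b\<in>(Basis :: (real^'d) set). lborel) (\<lambda>y. \<Prod>b\<in>Basis. K (y b))"
    using product_integrable_prod[of Basis "\<lambda>_. K"] K by simp
  then have "integrable lborel (\<lambda>y :: real^'d. \<Prod>b\<in>Basis. K (y \<bullet> b))"
    by (subst lborel_eq) (simp add: integrable_distr_eq inner_sum_left_Basis cong: prod.cong)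
  then show ?thesis
    using h by (subst integrable_lborel_affine_iff[where c = "- h" and t = x])
      (simp_all add: mollifier_scaleR)
qed

text \<open>Substituting \<open>a = x - h *\<^sub>R y\<close> cancels the normalisation of the
  mollifier and yields the integral of \<open>product_smoothing_error\<close> for
  \<open>I = Basis\<close>.\<close>

lemma convolve_mollifier:
  fixes f :: "real^'d::finite \<Rightarrow> real"
  assumes [measurable]: "K \<in> borel_measurable borel" "f \<in> borel_measurable borel" and h: "h > 0"
  shows "convolve (mollifier K h) f x
    = (\<integral>y. (\<Prod>b\<in>Basis. K (y b)) * f (x - (\<Sum>b\<in>Basis. (h * y b) *\<^sub>R b)) \<partial>(\<Pi>\<^sub>M b\<in>Basis. lborel))"
proof -
  have "convolve (mollifier K h) f x
      = h ^ CARD('d) * (\<integral>y. mollifier K h (h *\<^sub>R y) * f (x - h *\<^sub>R y) \<partial>lborel)"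
    unfolding convolve_def using h
    by (subst integral_lborel_affine[where c = "- h" and t = x]) simp_all
  also have "\<dots> = (\<integral>y. (\<Prod>b\<in>Basis. K (y \<bullet> b)) * f (x - h *\<^sub>R y) \<partial>lborel)"
    using h by (simp add: mollifier_scaleR)
  also have "\<dots> = (\<integral>y. (\<Prod>b\<in>Basis. K (y b)) * f (x - (\<Sum>b\<in>Basis. (h * y b) *\<^sub>R b)) \<partial>(\<Pi>\<^sub>M b\<in>Basis. lborel))"
    by (subst lborel_eq) (simp add: integral_distr inner_sum_left_Basis scaleR_sum_right cong: prod.cong)
  finally show ?thesis .
qed

text \<open>The best constant \<open>C\<close> in the bound \<open>C * h powr \<beta>\<close> for
  the smoothing error, uniform over \<open>B\<close>, all bandwidths and all points. As an extended
  supremum it is available for every kernel.\<close>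

definition smoothing_error :: "real \<Rightarrow> (real^'d::finite \<Rightarrow> real) set \<Rightarrow> (real \<Rightarrow> real) \<Rightarrow> ennreal" where
  "smoothing_error \<beta> B K =
     (SUP f\<in>B. SUP h\<in>{0<..}. SUP x. ennreal (\<bar>f x - convolve (mollifier K h) f x\<bar> / h powr \<beta>))"

lemma smoothing_error_upper:
  assumes "f \<in> B" "h > 0"
  shows "ennreal \<bar>f x - convolve (mollifier K h) f x\<bar> \<le> smoothing_error \<beta> B K * ennreal (h powr \<beta>)"
proof -
  let ?r = "\<bar>f x - convolve (mollifier K h) f x\<bar>"
  have "ennreal (?r / h powr \<beta>) \<le> smoothing_error \<beta> B K"
    unfolding smoothing_error_def
    by (rule SUP_upper2[OF assms(1)], rule SUP_upper2[of h], use assms in simp, rule SUP_upper) simp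
  from mult_right_mono[OF this, of "ennreal (h powr \<beta>)"]
  show ?thesis using assms(2) by (simp add: ennreal_mult[symmetric])
qed

lemma smoothing_error_finite:
  fixes B :: "(real^'d::finite \<Rightarrow> real) set"
  assumes \<beta>: "\<beta> > 0" and B: "hoelder_bounded \<beta> B" and K: "kernel_of_order (smoothness_order \<beta>) K"
    and mom: "integrable lborel (\<lambda>t. \<bar>t\<bar> powr \<beta> * \<bar>K t\<bar>)"
  shows "smoothing_error \<beta> B K < \<infinity>"
proof -
  from B obtain R0 where R0: "\<And>f. f \<in> B \<Longrightarrow> hoelder_norm \<beta> f \<le> ennreal R0" and sub: "B \<subseteq> hoelder_space \<beta>"
    unfolding hoelder_bounded_def by auto
  \<comment> \<open>For negative \<open>R0\<close> the value \<open>ennreal R0\<close> is 0 already,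
    so the truncated radius is still a bound.\<close>
  define R where "R = max 0 R0"
  have R: "hoelder_norm \<beta> f \<le> ennreal R" "R \<ge> 0" if "f \<in> B" for f
    using R0[OF that] by (auto simp: R_def max_def ennreal_neg split: if_splits)
  let ?m = "max 1 (\<integral>t. \<bar>K t\<bar> \<partial>lborel)" and ?s = "\<integral>t. \<bar>t\<bar> powr \<beta> * \<bar>K t\<bar> \<partial>lborel"
  \<comment> \<open>The bound of \<open>product_smoothing_error\<close> over all basis vectors with
    \<open>e = R * h powr \<beta> * ?s\<close>, divided by \<open>h powr \<beta>\<close>.\<close>
  define C where "C = real CARD('d) * ?m ^ CARD('d) * (R * ?s)"
  have "\<bar>f x - convolve (mollifier K h) f x\<bar> / h powr \<beta> \<le> C" if f: "f \<in> B" and h: "h > 0" for f h x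
  proof -
    have fm: "f \<in> borel_measurable borel"
      using f sub by (intro borel_measurable_continuous_onI hoelder_space_continuous) auto
    have "\<bar>convolve (mollifier K h) f x - f x\<bar>
        \<le> real (card (Basis :: (real^'d) set)) * ?m ^ card (Basis :: (real^'d) set) * (R * h powr \<beta> * ?s)"
      unfolding convolve_mollifier[OF kernel_of_orderD(1)[OF K] fm h]
    proof (rule product_smoothing_error[OF kernel_of_orderD(2)[OF K] fm])
      show "\<bar>f y\<bar> \<le> R" for y by (rule hoelder_bounded_sup[OF R[OF f]])
      show "\<bar>(\<integral>t. K t * f (z - (h * t) *\<^sub>R b) \<partial>lborel) - f z\<bar> \<le> R * h powr \<beta> * ?s"
        if "b \<in> Basis" for b z
        using that coordinate_smoothing_error[OF \<beta> _ R[OF f] K mom h] f sub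
        by (auto simp: Basis_vec_def)
    qed (use R[OF f] in auto)
    then show ?thesis using h by (simp add: C_def field_simps abs_minus_commute)
  qed
  then have "smoothing_error \<beta> B K \<le> ennreal C"
    unfolding smoothing_error_def by (intro SUP_least ennreal_leI) auto
  then show ?thesis by (simp add: le_less_trans[OF _ ennreal_less_top])
qed

section \<open>Consequences of equality in law\<close>

lemma same_law_measure:
  fixes \<xi> \<xi>' :: "nat \<Rightarrow> 'w \<Rightarrow> real^'d::finite"
  assumes law: "same_law M n \<xi> \<xi>'"
    and \<xi>: "\<And>j. j \<in> {1..n} \<Longrightarrow> \<xi> j \<in> borel_measurable M" "\<And>j. j \<in> {1..n} \<Longrightarrow> \<xi>' j \<in> borel_measurable M"
    and P: "Measurable.pred (\<Pi>\<^sub>M j\<in>{1..n}. borel) P"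
  shows "measure M {\<omega> \<in> space M. P (\<lambda>j\<in>{1..n}. \<xi> j \<omega>)} = measure M {\<omega> \<in> space M. P (\<lambda>j\<in>{1..n}. \<xi>' j \<omega>)}"
proof -
  let ?N = "\<Pi>\<^sub>M j\<in>{1..n}. (borel :: (real^'d) measure)"
  have *: "measure M {\<omega> \<in> space M. P (\<lambda>j\<in>{1..n}. \<eta> j \<omega>)}
      = measure (distr M ?N (\<lambda>\<omega>. \<lambda>j\<in>{1..n}. \<eta> j \<omega>)) {y \<in> space ?N. P y}"
    if "\<And>j. j \<in> {1..n} \<Longrightarrow> \<eta> j \<in> borel_measurable M" for \<eta>
  proof -
    have m: "(\<lambda>\<omega>. \<lambda>j\<in>{1..n}. \<eta> j \<omega>) \<in> measurable M ?N"
      by (rule measurable_restrict) (use that in auto)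
    show ?thesis
      using P measurable_space[OF m] by (subst measure_distr[OF m]) (auto intro!: arg_cong[where f = "measure M"])
  qed
  show ?thesis using *[of \<xi>, OF \<xi>(1)] *[of \<xi>', OF \<xi>(2)] law unfolding same_law_def by simp
qed

lemma same_law_expectation:
  fixes \<xi> \<xi>' :: "nat \<Rightarrow> 'w \<Rightarrow> real^'d::finite" and g :: "real^'d \<Rightarrow> real"
  assumes law: "same_law M n \<xi> \<xi>'"
    and \<xi>: "\<And>j. j \<in> {1..n} \<Longrightarrow> \<xi> j \<in> borel_measurable M" "\<And>j. j \<in> {1..n} \<Longrightarrow> \<xi>' j \<in> borel_measurable M"
    and g: "g \<in> borel_measurable borel" and j: "j \<in> {1..n}"
  shows "(\<integral>\<omega>. g (\<xi> j \<omega>) \<partial>M) = (\<integral>\<omega>. g (\<xi>' j \<omega>) \<partial>M)"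
proof -
  let ?N = "\<Pi>\<^sub>M j\<in>{1..n}. (borel :: (real^'d) measure)"
  have *: "(\<integral>\<omega>. g (\<eta> j \<omega>) \<partial>M) = (\<integral>y. g (y j) \<partial>distr M ?N (\<lambda>\<omega>. \<lambda>j\<in>{1..n}. \<eta> j \<omega>))"
    if "\<And>j. j \<in> {1..n} \<Longrightarrow> \<eta> j \<in> borel_measurable M" for \<eta>
  proof -
    have m: "(\<lambda>\<omega>. \<lambda>j\<in>{1..n}. \<eta> j \<omega>) \<in> measurable M ?N"
      by (rule measurable_restrict) (use that in auto)
    show ?thesis
      using j g by (subst integral_distr[OF m]) auto
  qed
  show ?thesis using *[of \<xi>, OF \<xi>(1)] *[of \<xi>', OF \<xi>(2)] law unfolding same_law_def by simp
qed

lemma P_exceed_le_2_Q_deviate: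
  fixes \<xi> \<xi>' :: "nat \<Rightarrow> 'w \<Rightarrow> real^'d::finite"
  assumes M: "prob_space M" and law: "same_law M n \<xi> \<xi>'"
    and \<xi>: "\<And>j. j \<in> {1..n} \<Longrightarrow> \<xi> j \<in> borel_measurable M" "\<And>j. j \<in> {1..n} \<Longrightarrow> \<xi>' j \<in> borel_measurable M"
    and [measurable]: "K \<in> borel_measurable borel" "\<psi> \<in> borel_measurable borel"
    and \<epsilon>: "\<epsilon> > 0"
  shows "P_exceed M \<epsilon> K \<psi> n h \<xi> \<xi>' a \<le> 2 * Q_deviate M \<epsilon> K \<psi> n h \<xi> a"
proof -
  interpret prob_space M by fact
  define g where "g x = mollifier K h (x - a) * \<psi> x" for x
  have [measurable]: "g \<in> borel_measurable borel" unfolding g_def[abs_def] by measurable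
  note [measurable] = \<xi>
  define m where "m j = (\<integral>\<omega>. g (\<xi> j \<omega>) \<partial>M)" for j
  define \<delta> where "\<delta> = \<epsilon> / (2 * (1 + \<epsilon>))"
  define T where "T = 1 / real n * (\<Sum>j=1..n. m j)"
  define S where "S \<eta> \<omega> = 1 / real n * (\<Sum>j=1..n. g (\<eta> j \<omega>))" for \<eta> :: "nat \<Rightarrow> 'w \<Rightarrow> real^'d" and \<omega>
  let ?Q = "\<lambda>\<eta>. {\<omega> \<in> space M. \<bar>S \<eta> \<omega> - T\<bar> \<ge> \<delta> * T}"
  have Q: "Q_deviate M \<epsilon> K \<psi> n h \<xi> a = measure M (?Q \<xi>)"
    unfolding Q_deviate_def Let_def g_def[symmetric] m_def[symmetric]
    by (simp add: T_def S_def \<delta>_def sum_subtractf right_diff_distrib mult.assoc diff_divide_distrib)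
  \<comment> \<open>\<open>T\<close> is a fixed number here, so the deviation of either sample mean
    from this one \<open>T\<close> is the same event of the tuple, and the joint laws of the tuples
    agree.\<close>
  have "measure M {\<omega> \<in> space M. (\<lambda>y. \<bar>1 / real n * (\<Sum>j=1..n. g (y j)) - T\<bar> \<ge> \<delta> * T) (\<lambda>j\<in>{1..n}. \<xi> j \<omega>)}
      = measure M {\<omega> \<in> space M. (\<lambda>y. \<bar>1 / real n * (\<Sum>j=1..n. g (y j)) - T\<bar> \<ge> \<delta> * T) (\<lambda>j\<in>{1..n}. \<xi>' j \<omega>)}"
    by (rule same_law_measure[OF law \<xi>]) auto
  then have Q': "measure M (?Q \<xi>') = measure M (?Q \<xi>)"
    by (simp add: S_def)
  have meas: "?Q \<xi> \<in> events" "?Q \<xi>' \<in> events"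
    unfolding S_def by measurable
  have "P_exceed M \<epsilon> K \<psi> n h \<xi> \<xi>' a = measure M {\<omega> \<in> space M. S \<xi>' \<omega> - (1 + \<epsilon>) * S \<xi> \<omega> > 0}"
    unfolding P_exceed_def g_def[symmetric] S_def by (simp add: mult.assoc)
  also have "\<dots> \<le> measure M (?Q \<xi> \<union> ?Q \<xi>')"
  proof (rule finite_measure_mono)
    have False if "\<bar>S \<xi> \<omega> - T\<bar> < \<delta> * T" "\<bar>S \<xi>' \<omega> - T\<bar> < \<delta> * T" "(1 + \<epsilon>) * S \<xi> \<omega> < S \<xi>' \<omega>" for \<omega>
    proof -
      \<comment> \<open>This choice closes the gap: \<open>(1 + \<epsilon>) * (1 - \<delta>) = 1 +
        \<epsilon> / 2 \<ge> 1 + \<delta>\<close>.\<close>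
      have \<delta>: "(1 + \<epsilon>) * \<delta> = \<epsilon> / 2" "\<delta> > 0" "\<delta> \<le> \<epsilon> / 2"
        using \<epsilon> by (auto simp: \<delta>_def field_simps)
      \<comment> \<open>\<open>K\<close> and \<open>\<psi>\<close> may be negative, so the sign of
        \<open>T\<close> is not known beforehand. For \<open>T \<le> 0\<close> the deviation event
        is the whole space; outside that event \<open>T\<close> must be positive.\<close>
      have "\<delta> * T > 0" using that(1) by linarith
      then have T: "T > 0" using \<delta>(2) by (simp add: zero_less_mult_iff)
      have "(1 + \<epsilon>) * (T - \<delta> * T) \<le> (1 + \<epsilon>) * S \<xi> \<omega>"
        using that(1) \<epsilon> by (intro mult_left_mono) auto
      moreover have "(1 + \<epsilon>) * (T - \<delta> * T) = (1 + \<epsilon>) * T - (1 + \<epsilon>) * \<delta> * T" by (simp add: algebra_simps)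
      moreover have "(1 + \<epsilon>) * \<delta> * T = \<epsilon> / 2 * T" by (simp only: \<delta>(1))
      moreover have "\<delta> * T \<le> \<epsilon> / 2 * T" using T \<delta>(3) by (intro mult_right_mono) auto
      ultimately show False using that(2,3) by (simp add: algebra_simps)
    qed
    then show "{\<omega> \<in> space M. S \<xi>' \<omega> - (1 + \<epsilon>) * S \<xi> \<omega> > 0} \<subseteq> ?Q \<xi> \<union> ?Q \<xi>'"
      by (auto simp: not_le[symmetric])
  qed (use meas in auto)
  also have "\<dots> \<le> measure M (?Q \<xi>) + measure M (?Q \<xi>')"
    using meas by (rule measure_Un_le)
  finally show ?thesis by (simp add: Q Q')
qed

section \<open>Estimates for a fixed outcome\<close>

lemma ennreal_abs_average_le:
  assumes n: "n \<ge> 1" and c: "\<And>j. j \<in> {1..n} \<Longrightarrow> ennreal \<bar>g j\<bar> \<le> c"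
  shows "ennreal \<bar>1 / real n * (\<Sum>j=1..n. g j)\<bar> \<le> c"
proof -
  have "ennreal \<bar>1 / real n * (\<Sum>j=1..n. g j)\<bar> \<le> ennreal (1 / real n * (\<Sum>j=1..n. \<bar>g j\<bar>))"
    using sum_abs[of g "{1..n}"] by (auto simp: abs_mult intro!: ennreal_leI divide_right_mono)
  also have "\<dots> = ennreal (1 / real n) * (\<Sum>j=1..n. ennreal \<bar>g j\<bar>)"
    by (subst ennreal_mult) (auto simp: sum_nonneg)
  also have "\<dots> \<le> ennreal (1 / real n) * (\<Sum>j=1..n. c)"
    by (intro mult_left_mono sum_mono c) auto
  also have "\<dots> = c"
    using n by (simp add: mult.assoc[symmetric] ennreal_of_nat_eq_real_of_nat ennreal_mult[symmetric])
  finally show ?thesis .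
qed

text \<open>The origin of \<open>2 + \<epsilon>\<close>: it is the sum of the weights 1 and
  \<open>1 + \<epsilon>\<close> of the two samples. The estimate serves both the kernel averages and
  the smoothing remainder.\<close>

lemma ennreal_abs_weighted_difference_le:
  assumes n: "n \<ge> 1" and \<epsilon>: "\<epsilon> \<ge> 0"
    and c: "\<And>j. j \<in> {1..n} \<Longrightarrow> ennreal \<bar>g j\<bar> \<le> c" "\<And>j. j \<in> {1..n} \<Longrightarrow> ennreal \<bar>g' j\<bar> \<le> c"
  shows "ennreal \<bar>1 / real n * (\<Sum>j=1..n. g' j) - (1 + \<epsilon>) * (1 / real n * (\<Sum>j=1..n. g j))\<bar> \<le> ennreal (2 + \<epsilon>) * c"
proof -
  let ?u = "1 / real n * (\<Sum>j=1..n. g j)" and ?v = "1 / real n * (\<Sum>j=1..n. g' j)"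
  have "\<bar>?v - (1 + \<epsilon>) * ?u\<bar> \<le> \<bar>?v\<bar> + (1 + \<epsilon>) * \<bar>?u\<bar>"
    using abs_triangle_ineq4[of ?v "(1 + \<epsilon>) * ?u"] \<epsilon> by (simp only: abs_mult) simp
  then have "ennreal \<bar>?v - (1 + \<epsilon>) * ?u\<bar> \<le> ennreal (\<bar>?v\<bar> + (1 + \<epsilon>) * \<bar>?u\<bar>)"
    by (rule ennreal_leI)
  also have "\<dots> = ennreal \<bar>?v\<bar> + ennreal (1 + \<epsilon>) * ennreal \<bar>?u\<bar>"
    using \<epsilon> by (simp only: ennreal_mult[symmetric] ennreal_plus[symmetric] abs_ge_zero mult_nonneg_nonneg)
  also have "\<dots> \<le> c + ennreal (1 + \<epsilon>) * c"
    by (intro add_mono mult_left_mono ennreal_abs_average_le n c) auto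
  also have "\<dots> = (ennreal 1 + ennreal (1 + \<epsilon>)) * c"
    by (simp add: distrib_right)
  also have "ennreal 1 + ennreal (1 + \<epsilon>) = ennreal (2 + \<epsilon>)"
    using \<epsilon> by (subst ennreal_plus[symmetric]) auto
  finally show ?thesis .
qed

lemma sup_norm_upper: "ennreal \<bar>f x\<bar> \<le> sup_norm f"
  unfolding sup_norm_def by (rule SUP_upper) simp

lemma mollifier_le:
  assumes "h > 0"
  shows "ennreal \<bar>mollifier K h (x :: real^'d::finite)\<bar> \<le> ennreal (1 / h ^ CARD('d)) * sup_norm K ^ CARD('d)"
proof -
  have "ennreal \<bar>mollifier K h x\<bar> = ennreal (1 / h ^ CARD('d)) * (\<Prod>i\<in>UNIV. ennreal \<bar>K (x $ i / h)\<bar>)"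
    using assms by (simp add: mollifier_def abs_mult abs_prod ennreal_mult prod_nonneg prod_ennreal
        divide_ennreal_def[symmetric] ennreal_mult[symmetric] del: ennreal_mult)
  also have "\<dots> \<le> ennreal (1 / h ^ CARD('d)) * (\<Prod>i\<in>(UNIV :: 'd set). sup_norm K)"
    by (intro mult_left_mono prod_mono_ennreal sup_norm_upper) auto
  finally show ?thesis by simp
qed

text \<open>For integrable \<open>f\<close> the right-hand side is the integral of the positive
  part; otherwise the Bochner integral is 0 by convention.\<close>

lemma ennreal_integral_le_nn_integral:
  "ennreal (integral\<^sup>L M f) \<le> (\<integral>\<^sup>+x. ennreal (f x) \<partial>M)"
proof (cases "integrable M f")
  case True
  have "integral\<^sup>L M f \<le> (\<integral>x. max 0 (f x) \<partial>M)"
    using True by (intro integral_mono) auto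
  also have "ennreal \<dots> = (\<integral>\<^sup>+x. ennreal (max 0 (f x)) \<partial>M)"
    using True by (intro nn_integral_eq_integral[symmetric]) auto
  also have "(\<lambda>x. ennreal (max 0 (f x))) = (\<lambda>x. ennreal (f x))"
    by (auto simp: max_def ennreal_neg)
  finally show ?thesis by (simp add: ennreal_leI)
qed (simp add: not_integrable_integral_eq)

text \<open>The quantity \<open>D(a)\<close> for one outcome: the samples are plain sequences of
  points, so the integration over \<open>a\<close> can be done before any probability
  enters.\<close>

definition empirical_difference :: "real \<Rightarrow> (real \<Rightarrow> real) \<Rightarrow> (real^'d::finite \<Rightarrow> real) \<Rightarrow> nat \<Rightarrow> real \<Rightarrow>
    (nat \<Rightarrow> real^'d) \<Rightarrow> (nat \<Rightarrow> real^'d) \<Rightarrow> real^'d \<Rightarrow> real" where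
  "empirical_difference \<epsilon> K \<psi> n h x x' a =
     1 / real n * (\<Sum>j=1..n. mollifier K h (x' j - a) * \<psi> (x' j))
     - (1 + \<epsilon>) * (1 / real n * (\<Sum>j=1..n. mollifier K h (x j - a) * \<psi> (x j)))"

lemma empirical_difference_le:
  fixes \<psi> :: "real^'d::finite \<Rightarrow> real"
  assumes "n \<ge> 1" "\<epsilon> \<ge> 0" "h > 0"
  shows "ennreal (empirical_difference \<epsilon> K \<psi> n h x x' a)
    \<le> ennreal (2 + \<epsilon>) * (ennreal (1 / h ^ CARD('d)) * sup_norm K ^ CARD('d) * sup_norm \<psi>)"
proof -
  have *: "ennreal \<bar>mollifier K h (y - a) * \<psi> y\<bar>
      \<le> ennreal (1 / h ^ CARD('d)) * sup_norm K ^ CARD('d) * sup_norm \<psi>" for y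
    unfolding abs_mult
    by (subst ennreal_mult) (auto intro!: mult_mono mollifier_le assms sup_norm_upper)
  have "ennreal (empirical_difference \<epsilon> K \<psi> n h x x' a) \<le> ennreal \<bar>empirical_difference \<epsilon> K \<psi> n h x x' a\<bar>"
    by (rule ennreal_leI) simp
  also have "\<dots> \<le> ennreal (2 + \<epsilon>) * (ennreal (1 / h ^ CARD('d)) * sup_norm K ^ CARD('d) * sup_norm \<psi>)"
    unfolding empirical_difference_def by (rule ennreal_abs_weighted_difference_le) (use assms * in auto)
  finally show ?thesis .
qed

text \<open>Integrating \<open>f a\<close> times a mollifier centred at a sample point gives the
  convolution at that point. By linearity the integral of \<open>f a\<close> times the empirical
  difference is the left-hand expression with \<open>f\<close> smoothed, and \<open>\<delta>\<close>
  controls the replacement of \<open>f\<close> by its smoothed version.\<close>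

lemma weighted_average_difference_le:
  fixes f :: "real^'d::finite \<Rightarrow> real"
  assumes K: "integrable lborel K" and h: "h > 0" and n: "n \<ge> 1" and \<epsilon>: "\<epsilon> \<ge> 0"
    and f: "f \<in> borel_measurable borel" "\<And>x. f x \<ge> 0" "\<And>x. f x \<le> R"
    and err: "\<And>x. ennreal \<bar>f x - convolve (mollifier K h) f x\<bar> \<le> \<delta>"
  shows "ennreal (1 / real n * (\<Sum>j=1..n. f (x' j) * \<psi> (x' j)) - (1 + \<epsilon>) * (1 / real n * (\<Sum>j=1..n. f (x j) * \<psi> (x j))))
    \<le> (\<integral>\<^sup>+a. ennreal (f a) * ennreal (empirical_difference \<epsilon> K \<psi> n h x x' a) \<partial>lborel)
      + ennreal (2 + \<epsilon>) * (\<delta> * sup_norm \<psi>)"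
proof -
  let ?D = "empirical_difference \<epsilon> K \<psi> n h x x'"
  let ?c = "convolve (mollifier K h) f"
  have Km: "K \<in> borel_measurable borel" using borel_measurable_integrable[OF K] by simp
  note [measurable] = f(1) Km
  have int: "integrable lborel (\<lambda>a. mollifier K h (y - a) * f a)" for y
  proof (rule Bochner_Integration.integrable_bound)
    show "integrable lborel (\<lambda>a. R * mollifier K h (y - a))"
      using integrable_mollifier[OF K h, of y] by simp
    have "\<bar>f a\<bar> \<le> \<bar>R\<bar>" for a using f(2,3)[of a] by linarith
    then show "AE a in lborel. norm (mollifier K h (y - a) * f a) \<le> norm (R * mollifier K h (y - a))"
      by (auto simp: abs_mult mult.commute[of "\<bar>R\<bar>"] intro!: mult_left_mono)
  qed simp
  have eqf: "f a * ?D a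
      = 1 / real n * (\<Sum>j=1..n. (mollifier K h (x' j - a) * f a) * \<psi> (x' j))
        - (1 + \<epsilon>) * (1 / real n * (\<Sum>j=1..n. (mollifier K h (x j - a) * f a) * \<psi> (x j)))" for a
    by (simp add: empirical_difference_def algebra_simps sum_distrib_left)
  have ints: "integrable lborel (\<lambda>a. \<Sum>j=1..n. (mollifier K h (z j - a) * f a) * \<psi> (z j))" for z
    using int by (intro Bochner_Integration.integrable_sum integrable_mult_left) auto
  have eqs: "(\<integral>a. (\<Sum>j=1..n. (mollifier K h (z j - a) * f a) * \<psi> (z j)) \<partial>lborel)
      = (\<Sum>j=1..n. ?c (z j) * \<psi> (z j))" for z
    using int by (subst Bochner_Integration.integral_sum) (auto simp: convolve_def)
  have eqI: "(\<integral>a. f a * ?D a \<partial>lborel) = 1 / real n * (\<Sum>j=1..n. ?c (x' j) * \<psi> (x' j))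
      - (1 + \<epsilon>) * (1 / real n * (\<Sum>j=1..n. ?c (x j) * \<psi> (x j)))"
    unfolding eqf using ints
    by (subst Bochner_Integration.integral_diff) (auto simp only: integrable_mult_right integral_mult_right_zero eqs)
  let ?r = "\<lambda>y. f y - ?c y"
  let ?E = "1 / real n * (\<Sum>j=1..n. ?r (x' j) * \<psi> (x' j)) - (1 + \<epsilon>) * (1 / real n * (\<Sum>j=1..n. ?r (x j) * \<psi> (x j)))"
  have split: "1 / real n * (\<Sum>j=1..n. f (x' j) * \<psi> (x' j)) - (1 + \<epsilon>) * (1 / real n * (\<Sum>j=1..n. f (x j) * \<psi> (x j)))
      = (\<integral>a. f a * ?D a \<partial>lborel) + ?E"
    unfolding eqI by (simp add: left_diff_distrib sum_subtractf algebra_simps)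
  have "ennreal ?E \<le> ennreal \<bar>?E\<bar>" by (rule ennreal_leI) simp
  also have "\<dots> \<le> ennreal (2 + \<epsilon>) * (\<delta> * sup_norm \<psi>)"
  proof (rule ennreal_abs_weighted_difference_le[OF n \<epsilon>])
    have *: "ennreal \<bar>?r y * \<psi> y\<bar> \<le> \<delta> * sup_norm \<psi>" for y
      unfolding abs_mult by (subst ennreal_mult) (auto intro!: mult_mono err sup_norm_upper)
    show "ennreal \<bar>?r (x j) * \<psi> (x j)\<bar> \<le> \<delta> * sup_norm \<psi>" "ennreal \<bar>?r (x' j) * \<psi> (x' j)\<bar> \<le> \<delta> * sup_norm \<psi>" for j
      by (rule *)+
  qed
  finally have E: "ennreal ?E \<le> ennreal (2 + \<epsilon>) * (\<delta> * sup_norm \<psi>)" .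
  \<comment> \<open>Since \<open>f\<close> is nonnegative, truncating the product truncates
    \<open>?D a\<close>; only points with \<open>?D a > 0\<close> survive.\<close>
  have "ennreal (\<integral>a. f a * ?D a \<partial>lborel) \<le> (\<integral>\<^sup>+a. ennreal (f a * ?D a) \<partial>lborel)"
    by (rule ennreal_integral_le_nn_integral)
  also have "\<dots> = (\<integral>\<^sup>+a. ennreal (f a) * ennreal (?D a) \<partial>lborel)"
    using f(2) by (simp add: ennreal_mult')
  finally have I: "ennreal (\<integral>a. f a * ?D a \<partial>lborel) \<le> (\<integral>\<^sup>+a. ennreal (f a) * ennreal (?D a) \<partial>lborel)" .
  \<comment> \<open>Truncation at 0 is only subadditive when summands may be negative, hence the
    cases on both signs.\<close>
  have "ennreal ((\<integral>a. f a * ?D a \<partial>lborel) + ?E) \<le> ennreal (\<integral>a. f a * ?D a \<partial>lborel) + ennreal ?E"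
    by (cases "(\<integral>a. f a * ?D a \<partial>lborel) \<ge> 0"; cases "?E \<ge> 0")
       (auto simp: ennreal_neg ennreal_plus[symmetric] simp del: ennreal_plus intro!: ennreal_leI)
  also have "\<dots> \<le> (\<integral>\<^sup>+a. ennreal (f a) * ennreal (?D a) \<partial>lborel) + ennreal (2 + \<epsilon>) * (\<delta> * sup_norm \<psi>)"
    by (intro add_mono I E)
  finally show ?thesis unfolding split .
qed

section \<open>Taking expectations\<close>

lemma E_diff_le:
  fixes V :: "'w \<Rightarrow> real^'d::finite \<Rightarrow> real"
  assumes M: "prob_space M" and K: "integrable lborel K" and B: "hoelder_bounded \<beta> B"
    and X: "X \<in> sets borel" and \<psi>: "\<psi> \<in> borel_measurable borel" "bounded (range \<psi>)"
    and V: "V \<in> measurable M (hoelder_borel \<beta>)" "AE \<omega> in M. V \<omega> \<in> B" "AE \<omega> in M. \<forall>x. V \<omega> x \<ge> 0"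
    and h: "h > 0" and \<epsilon>: "\<epsilon> \<ge> 0" and n: "n \<ge> 1"
    and \<xi>: "\<And>j. j \<in> {1..n} \<Longrightarrow> \<xi> j \<in> borel_measurable M" "\<And>j. j \<in> {1..n} \<Longrightarrow> \<xi>' j \<in> borel_measurable M"
    and err: "AE \<omega> in M. \<forall>x. ennreal \<bar>V \<omega> x - convolve (mollifier K h) (V \<omega>) x\<bar> \<le> \<delta>"
    and v: "AE \<omega> in M. sup_norm (V \<omega>) \<le> v"
    and p: "\<And>a. a \<in> X \<Longrightarrow> ennreal (P_exceed M \<epsilon> K \<psi> n h \<xi> \<xi>' a) \<le> p"
  shows "ennreal (E_diff M \<epsilon> \<psi> n V \<xi> \<xi>')
    \<le> ennreal (2 + \<epsilon>) * (ennreal (1 / h ^ CARD('d)) * sup_norm K ^ CARD('d) * sup_norm \<psi>)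
        * (v * p * emeasure lborel X + tail_mass M X V)
      + ennreal (2 + \<epsilon>) * (\<delta> * sup_norm \<psi>)"
proof -
  interpret prob_space M by fact
  interpret pair_sigma_finite lborel M ..
  define c where "c = ennreal (2 + \<epsilon>) * (ennreal (1 / h ^ CARD('d)) * sup_norm K ^ CARD('d) * sup_norm \<psi>)"
  define D where "D \<omega> a = empirical_difference \<epsilon> K \<psi> n h (\<lambda>j. \<xi> j \<omega>) (\<lambda>j. \<xi>' j \<omega>) a" for \<omega> a
  define Z where "Z \<omega> = 1 / real n * (\<Sum>j=1..n. V \<omega> (\<xi>' j \<omega>) * \<psi> (\<xi>' j \<omega>))
      - (1 + \<epsilon>) * (1 / real n * (\<Sum>j=1..n. V \<omega> (\<xi> j \<omega>) * \<psi> (\<xi> j \<omega>)))" for \<omega>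
  have Km: "K \<in> borel_measurable borel" using borel_measurable_integrable[OF K] by simp
  note [measurable] = Km \<psi>(1) X \<xi> hoelder_borel_jointly_measurable[OF V(1)]
  have Vm[measurable]: "(\<lambda>p. V (snd p) (fst p)) \<in> borel_measurable (lborel \<Otimes>\<^sub>M M)"
    using measurable_compose[OF _ hoelder_borel_jointly_measurable[OF V(1)],
      of "\<lambda>p. (snd p, fst p)" "lborel \<Otimes>\<^sub>M M"] by simp
  have Va[measurable]: "(\<lambda>\<omega>. V \<omega> a) \<in> borel_measurable M" for a
    using measurable_compose[OF measurable_Pair1' Vm, of a] by auto
  have Dm[measurable]: "(\<lambda>p. D (snd p) (fst p)) \<in> borel_measurable (lborel \<Otimes>\<^sub>M M)"
    unfolding D_def empirical_difference_def by measurable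
  from B obtain R where R: "\<And>f. f \<in> B \<Longrightarrow> hoelder_norm \<beta> f \<le> ennreal R"
    unfolding hoelder_bounded_def by auto
  have Rf: "\<bar>f x\<bar> \<le> max 0 R" if "f \<in> B" for f x
    using R[OF that] by (intro hoelder_bounded_sup[of \<beta>]) (auto simp: max_def ennreal_neg)
  from \<psi>(2) obtain b where b: "\<And>x. \<bar>\<psi> x\<bar> \<le> b" by (auto simp: bounded_iff)
  \<comment> \<open>Boundedness of \<open>B\<close> and of \<open>\<psi>\<close> makes both
    expectations genuine, so that their difference is the expectation of \<open>Z\<close>.\<close>
  have int: "integrable M (\<lambda>\<omega>. V \<omega> (\<eta> \<omega>) * \<psi> (\<eta> \<omega>))" if [measurable]: "\<eta> \<in> borel_measurable M" for \<eta>
  proof (rule integrable_const_bound[where B = "max 0 R * b"])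
    show "AE \<omega> in M. norm (V \<omega> (\<eta> \<omega>) * \<psi> (\<eta> \<omega>)) \<le> max 0 R * b"
      using V(2) by eventually_elim (auto simp: abs_mult intro!: mult_mono Rf b)
    have "(\<lambda>\<omega>. V \<omega> (\<eta> \<omega>)) \<in> borel_measurable M"
      using measurable_compose[OF _ hoelder_borel_jointly_measurable[OF V(1)], of "\<lambda>\<omega>. (\<omega>, \<eta> \<omega>)" M] by simp
    then show "(\<lambda>\<omega>. V \<omega> (\<eta> \<omega>) * \<psi> (\<eta> \<omega>)) \<in> borel_measurable M" by measurable
  qed
  have "E_diff M \<epsilon> \<psi> n V \<xi> \<xi>' = (\<integral>\<omega>. Z \<omega> \<partial>M)"
    unfolding E_diff_def Z_def using int \<xi>
    by (subst Bochner_Integration.integral_diff) (auto intro!: integrable_mult_right Bochner_Integration.integrable_sum)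
  then have "ennreal (E_diff M \<epsilon> \<psi> n V \<xi> \<xi>') \<le> (\<integral>\<^sup>+\<omega>. ennreal (Z \<omega>) \<partial>M)"
    by (simp add: ennreal_integral_le_nn_integral)
  also have "\<dots> \<le> (\<integral>\<^sup>+\<omega>. (\<integral>\<^sup>+a. ennreal (V \<omega> a) * ennreal (D \<omega> a) \<partial>lborel) + ennreal (2 + \<epsilon>) * (\<delta> * sup_norm \<psi>) \<partial>M)"
  proof (rule nn_integral_mono_AE)
    show "AE \<omega> in M. ennreal (Z \<omega>) \<le> (\<integral>\<^sup>+a. ennreal (V \<omega> a) * ennreal (D \<omega> a) \<partial>lborel) + ennreal (2 + \<epsilon>) * (\<delta> * sup_norm \<psi>)"
      using V(2,3) err
    proof eventually_elim
      case (elim \<omega>)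
      have "V \<omega> \<in> borel_measurable borel"
        using elim(1) B by (intro borel_measurable_continuous_onI hoelder_space_continuous[of _ \<beta>])
          (auto simp: hoelder_bounded_def)
      then show ?case
        unfolding Z_def D_def using elim Rf[OF elim(1)]
        by (intro weighted_average_difference_le[OF K h n \<epsilon>, where R = "max 0 R"]) (auto simp: abs_le_iff)
    qed
  qed
  also have "\<dots> = (\<integral>\<^sup>+\<omega>. (\<integral>\<^sup>+a. ennreal (V \<omega> a) * ennreal (D \<omega> a) \<partial>lborel) \<partial>M) + ennreal (2 + \<epsilon>) * (\<delta> * sup_norm \<psi>)"
  proof -
    have "(\<lambda>p. ennreal (V (snd p) (fst p)) * ennreal (D (snd p) (fst p))) \<in> borel_measurable (lborel \<Otimes>\<^sub>M M)"
      by measurable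
    from lborel.borel_measurable_nn_integral[OF measurable_pair_swap[OF this, simplified]]
    have "(\<lambda>\<omega>. \<integral>\<^sup>+a. ennreal (V \<omega> a) * ennreal (D \<omega> a) \<partial>lborel) \<in> borel_measurable M"
      by (simp add: case_prod_beta)
    then show ?thesis
      by (subst nn_integral_add) (auto simp: emeasure_space_1)
  qed
  also have "(\<integral>\<^sup>+\<omega>. (\<integral>\<^sup>+a. ennreal (V \<omega> a) * ennreal (D \<omega> a) \<partial>lborel) \<partial>M)
      = (\<integral>\<^sup>+a. (\<integral>\<^sup>+\<omega>. ennreal (V \<omega> a) * ennreal (D \<omega> a) \<partial>M) \<partial>lborel)"
    using Fubini'[of "\<lambda>a \<omega>. ennreal (V \<omega> a) * ennreal (D \<omega> a)"] by (simp add: case_prod_beta)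
  also have "\<dots> \<le> (\<integral>\<^sup>+a. c * v * p * indicator X a + c * (\<integral>\<^sup>+\<omega>. ennreal (V \<omega> a) \<partial>M) * indicator (- X) a \<partial>lborel)"
  proof (rule nn_integral_mono)
    fix a :: "real^'d"
    have Dc: "ennreal (D \<omega> a) \<le> c" for \<omega>
      unfolding D_def c_def by (rule empirical_difference_le[OF n \<epsilon> h])
    have [measurable]: "(\<lambda>\<omega>. D \<omega> a) \<in> borel_measurable M"
      using measurable_compose[OF measurable_Pair1' Dm, of a] by auto
    show "(\<integral>\<^sup>+\<omega>. ennreal (V \<omega> a) * ennreal (D \<omega> a) \<partial>M)
        \<le> c * v * p * indicator X a + c * (\<integral>\<^sup>+\<omega>. ennreal (V \<omega> a) \<partial>M) * indicator (- X) a"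
    proof (cases "a \<in> X")
      case True
      have "(\<integral>\<^sup>+\<omega>. ennreal (V \<omega> a) * ennreal (D \<omega> a) \<partial>M) \<le> (\<integral>\<^sup>+\<omega>. v * c * indicator {\<omega> \<in> space M. D \<omega> a > 0} \<omega> \<partial>M)"
      proof (rule nn_integral_mono_AE)
        show "AE \<omega> in M. ennreal (V \<omega> a) * ennreal (D \<omega> a) \<le> v * c * indicator {\<omega> \<in> space M. D \<omega> a > 0} \<omega>"
          using v AE_space
        proof eventually_elim
          case (elim \<omega>)
          have "ennreal (V \<omega> a) \<le> ennreal \<bar>V \<omega> a\<bar>" by (rule ennreal_leI) simp
          also have "\<dots> \<le> v" using sup_norm_upper[of "V \<omega>" a] elim by simp
          finally have "ennreal (V \<omega> a) \<le> v" .
          \<comment> \<open>Off the event \<open>ennreal (D \<omega> a)\<close> is 0, so the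
            indicator comes for free.\<close>
          then show ?case using Dc[of \<omega>] elim
            by (auto simp: indicator_def ennreal_neg not_less intro!: mult_mono)
        qed
      qed
      also have "\<dots> = v * c * ennreal (P_exceed M \<epsilon> K \<psi> n h \<xi> \<xi>' a)"
        by (subst nn_integral_cmult_indicator)
           (auto simp: P_exceed_def D_def empirical_difference_def emeasure_eq_measure mult.assoc)
      also have "\<dots> \<le> v * c * p" by (intro mult_left_mono p True) auto
      finally show ?thesis using True by (simp add: mult_ac)
    next
      case False
      have "(\<integral>\<^sup>+\<omega>. ennreal (V \<omega> a) * ennreal (D \<omega> a) \<partial>M) \<le> (\<integral>\<^sup>+\<omega>. c * ennreal (V \<omega> a) \<partial>M)"
        using Dc by (intro nn_integral_mono) (auto simp: mult.commute[of c] intro!: mult_left_mono)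
      then show ?thesis using False by (simp add: nn_integral_cmult)
    qed
  qed
  also have "\<dots> = c * v * p * emeasure lborel X + c * (\<integral>\<^sup>+a. (\<integral>\<^sup>+\<omega>. ennreal (V \<omega> a) * indicator (- X) a \<partial>M) \<partial>lborel)"
  proof -
    have "(\<lambda>a. \<integral>\<^sup>+\<omega>. ennreal (V \<omega> a) \<partial>M) \<in> borel_measurable lborel"
      by measurable
    then show ?thesis
      by (subst nn_integral_add)
         (auto simp: nn_integral_cmult_indicator nn_integral_multc mult.assoc nn_integral_cmult)
  qed
  \<comment> \<open>A second exchange of integrals, because \<open>tail_mass\<close> has the
    integral over \<open>a\<close> inside.\<close>
  also have "(\<integral>\<^sup>+a. (\<integral>\<^sup>+\<omega>. ennreal (V \<omega> a) * indicator (- X) a \<partial>M) \<partial>lborel) = tail_mass M X V"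
    unfolding tail_mass_def
    using Fubini'[of "\<lambda>a \<omega>. ennreal (V \<omega> a) * indicator (- X) a"] by (simp add: case_prod_beta)
  finally show ?thesis unfolding c_def[symmetric] by (simp add: distrib_left mult.assoc)
qed

section \<open>The constants and the three inequalities\<close>

text \<open>Recovers a signed inequality from a truncated one: a negative \<open>x\<close> lies
  below every extended nonnegative value anyway.\<close>

lemma ereal_le_enn2ereal: "ennreal x \<le> y \<Longrightarrow> ereal x \<le> enn2ereal y"
  by (metis enn2ereal_ennreal enn2ereal_nonneg ennreal_neg ereal_less_eq(3) less_eq_ennreal.rep_eq linorder_le_cases order_trans zero_ereal_def)

theorem theorem2p2:
  shows "\<exists>(CX :: (real^'d::finite) set \<Rightarrow> (real \<Rightarrow> real) \<Rightarrow> ennreal)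
          (CB :: real \<Rightarrow> (real^'d \<Rightarrow> real) set \<Rightarrow> (real \<Rightarrow> real) \<Rightarrow> ennreal).
    (\<forall>X K. X \<in> sets borel \<longrightarrow> emeasure lborel X < \<infinity> \<longrightarrow> sup_norm K < \<infinity> \<longrightarrow> CX X K < \<infinity>) \<and>
    (\<forall>\<beta> B K. \<beta> > 0 \<longrightarrow> hoelder_bounded \<beta> B \<longrightarrow> kernel_of_order (smoothness_order \<beta>) K \<longrightarrow>
       integrable lborel (\<lambda>x. \<bar>x\<bar> powr \<beta> * \<bar>K x\<bar>) \<longrightarrow> CB \<beta> B K < \<infinity>) \<and>
    (\<forall>(\<beta>::real) (K :: real \<Rightarrow> real) (B :: (real^'d \<Rightarrow> real) set) (X :: (real^'d) set)
      (\<psi> :: real^'d \<Rightarrow> real) (M :: 'w measure) (V :: nat \<Rightarrow> 'w \<Rightarrow> real^'d \<Rightarrow> real)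
      (d :: nat \<Rightarrow> real) (\<epsilon>::real) (\<xi> :: nat \<Rightarrow> nat \<Rightarrow> 'w \<Rightarrow> real^'d)
      (\<xi>' :: nat \<Rightarrow> nat \<Rightarrow> 'w \<Rightarrow> real^'d).
      \<beta> > 0 \<longrightarrow>
      kernel_of_order (smoothness_order \<beta>) K \<longrightarrow>
      hoelder_bounded \<beta> B \<longrightarrow>
      X \<in> sets borel \<longrightarrow>
      \<psi> \<in> borel_measurable borel \<longrightarrow> bounded (range \<psi>) \<longrightarrow>
      prob_space M \<longrightarrow>
      (\<forall>n\<ge>1. V n \<in> measurable M (hoelder_borel \<beta>) \<and>
             (AE \<omega> in M. V n \<omega> \<in> B) \<and> (AE \<omega> in M. \<forall>x. V n \<omega> x \<ge> 0)) \<longrightarrow>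
      (\<forall>n\<ge>1. d n > 0) \<longrightarrow> d \<longlonglongrightarrow> 0 \<longrightarrow>
      0 < \<epsilon> \<longrightarrow> \<epsilon> \<le> 1 \<longrightarrow>
      (\<forall>n\<ge>1. \<forall>j\<in>{1..n}. \<xi> n j \<in> borel_measurable M \<and> \<xi>' n j \<in> borel_measurable M) \<longrightarrow>
      (\<forall>n\<ge>1. ereal (E_diff M \<epsilon> \<psi> n (V n) (\<xi> n) (\<xi>' n)) \<le> enn2ereal (
          CX X K * (SUP m\<in>{1..}. ess_sup_norm M (V m)) * sup_norm \<psi> * ennreal (1 / d n ^ CARD('d))
            * (SUP a\<in>X. ennreal (P_exceed M \<epsilon> K \<psi> n (d n) (\<xi> n) (\<xi>' n) a))
          + CB \<beta> B K * sup_norm \<psi> * ennreal (d n powr \<beta>)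
          + ennreal (2 + \<epsilon>) * ennreal (1 / d n ^ CARD('d)) * sup_norm K ^ CARD('d) * sup_norm \<psi>
            * tail_mass M X (V n))) \<and>
      ((\<forall>n\<ge>1. same_law M n (\<xi> n) (\<xi>' n)) \<longrightarrow>
        (\<forall>n\<ge>1. ereal (E_diff M \<epsilon> \<psi> n (V n) (\<xi> n) (\<xi>' n)) \<le> enn2ereal (
            2 * CX X K * (SUP m\<in>{1..}. ess_sup_norm M (V m)) * sup_norm \<psi> * ennreal (1 / d n ^ CARD('d))
              * (SUP a\<in>X. ennreal (Q_deviate M \<epsilon> K \<psi> n (d n) (\<xi> n) a))
            + CB \<beta> B K * sup_norm \<psi> * ennreal (d n powr \<beta>)
            + ennreal (2 + \<epsilon>) * ennreal (1 / d n ^ CARD('d)) * sup_norm K ^ CARD('d) * sup_norm \<psi>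
              * tail_mass M X (V n))) \<and>
        ((\<forall>n\<ge>1. AE \<omega> in M. convolve (mollifier K (d n)) (V n \<omega>) = V n \<omega>) \<longrightarrow>
          (\<forall>n\<ge>1. ereal (E_diff M \<epsilon> \<psi> n (V n) (\<xi> n) (\<xi>' n)) \<le> enn2ereal (
            2 * CX X K * (SUP m\<in>{1..}. ess_sup_norm M (V m)) * sup_norm \<psi> * ennreal (1 / d n ^ CARD('d))
              * (SUP a\<in>X. ennreal (Q_deviate M \<epsilon> K \<psi> n (d n) (\<xi> n) a))
            + ennreal (2 + \<epsilon>) * ennreal (1 / d n ^ CARD('d)) * sup_norm K ^ CARD('d) * sup_norm \<psi>
              * tail_mass M X (V n))))))"
proof -
  \<comment> \<open>The volume comes from integrating a constant over \<open>X\<close>, the power of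
    the sup norm from the pointwise bound on the mollifier, and 3 from
    \<open>\<epsilon> \<le> 1\<close>.\<close>
  define CX :: "(real^'d) set \<Rightarrow> (real \<Rightarrow> real) \<Rightarrow> ennreal" where
    "CX X K = 3 * emeasure lborel X * sup_norm K ^ CARD('d)" for X K
  define CB :: "real \<Rightarrow> (real^'d \<Rightarrow> real) set \<Rightarrow> (real \<Rightarrow> real) \<Rightarrow> ennreal" where
    "CB \<beta> B K = 3 * smoothing_error \<beta> B K" for \<beta> B K
  \<comment> \<open>Here \<open>2 + \<epsilon>\<close> is enlarged to 3 in the terms that carry the
    constants and kept in the tail term.\<close>
  have bound: "ereal (E_diff M \<epsilon> \<psi> n V \<xi> \<xi>') \<le> enn2ereal (
      CX X K * v * sup_norm \<psi> * ennreal (1 / h ^ CARD('d)) * p + 3 * \<delta> * sup_norm \<psi>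
      + ennreal (2 + \<epsilon>) * ennreal (1 / h ^ CARD('d)) * sup_norm K ^ CARD('d) * sup_norm \<psi> * tail_mass M X V)"
    if "\<epsilon> \<le> 1" and le: "ennreal (E_diff M \<epsilon> \<psi> n V \<xi> \<xi>')
      \<le> ennreal (2 + \<epsilon>) * (ennreal (1 / h ^ CARD('d)) * sup_norm K ^ CARD('d) * sup_norm \<psi>)
          * (v * p * emeasure lborel X + tail_mass M X V)
        + ennreal (2 + \<epsilon>) * (\<delta> * sup_norm \<psi>)"
    for M :: "'w measure" and \<epsilon> \<psi> n V \<xi> \<xi>' X K v h p \<delta>
  proof (rule ereal_le_enn2ereal, rule order.trans[OF le])
    have \<epsilon>3: "ennreal (2 + \<epsilon>) \<le> 3"
      using \<open>\<epsilon> \<le> 1\<close> ennreal_leI[of "2 + \<epsilon>" 3] by simp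
    let ?m = "ennreal (1 / h ^ CARD('d)) * sup_norm K ^ CARD('d) * sup_norm \<psi>"
    have "ennreal (2 + \<epsilon>) * ?m * (v * p * emeasure lborel X + tail_mass M X V) + ennreal (2 + \<epsilon>) * (\<delta> * sup_norm \<psi>)
        = ennreal (2 + \<epsilon>) * (?m * v * p * emeasure lborel X) + ennreal (2 + \<epsilon>) * (\<delta> * sup_norm \<psi>)
          + ennreal (2 + \<epsilon>) * ?m * tail_mass M X V"
      by (simp add: distrib_left mult_ac add_ac)
    also have "\<dots> \<le> 3 * (?m * v * p * emeasure lborel X) + 3 * (\<delta> * sup_norm \<psi>)
          + ennreal (2 + \<epsilon>) * ?m * tail_mass M X V"
      by (intro add_mono mult_right_mono \<epsilon>3) auto
    finally show "ennreal (2 + \<epsilon>) * ?m * (v * p * emeasure lborel X + tail_mass M X V) + ennreal (2 + \<epsilon>) * (\<delta> * sup_norm \<psi>)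
        \<le> CX X K * v * sup_norm \<psi> * ennreal (1 / h ^ CARD('d)) * p + 3 * \<delta> * sup_norm \<psi>
          + ennreal (2 + \<epsilon>) * ennreal (1 / h ^ CARD('d)) * sup_norm K ^ CARD('d) * sup_norm \<psi> * tail_mass M X V"
      by (simp add: CX_def mult_ac)
  qed
  show ?thesis
  proof (rule exI[of _ CX], rule exI[of _ CB], intro conjI allI impI)
    fix X :: "(real^'d) set" and K :: "real \<Rightarrow> real"
    assume "emeasure lborel X < \<infinity>" "sup_norm K < \<infinity>"
    then show "CX X K < \<infinity>"
      by (simp add: CX_def ennreal_mult_less_top power_less_top_ennreal)
  next
    fix \<beta> :: real and B :: "(real^'d \<Rightarrow> real) set" and K :: "real \<Rightarrow> real"
    assume "\<beta> > 0" "hoelder_bounded \<beta> B" "kernel_of_order (smoothness_order \<beta>) K"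
      "integrable lborel (\<lambda>x. \<bar>x\<bar> powr \<beta> * \<bar>K x\<bar>)"
    then have "smoothing_error \<beta> B K < \<infinity>" by (rule smoothing_error_finite)
    then show "CB \<beta> B K < \<infinity>" by (simp add: CB_def ennreal_mult_less_top)
  next
    fix \<beta> :: real and K :: "real \<Rightarrow> real" and B :: "(real^'d \<Rightarrow> real) set" and X :: "(real^'d) set"
      and \<psi> :: "real^'d \<Rightarrow> real" and M :: "'w measure" and V :: "nat \<Rightarrow> 'w \<Rightarrow> real^'d \<Rightarrow> real"
      and d :: "nat \<Rightarrow> real" and \<epsilon> :: real and \<xi> \<xi>' :: "nat \<Rightarrow> nat \<Rightarrow> 'w \<Rightarrow> real^'d" and n :: nat
    assume \<beta>: "\<beta> > 0" and K: "kernel_of_order (smoothness_order \<beta>) K" and B: "hoelder_bounded \<beta> B"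
      and X: "X \<in> sets borel" and \<psi>: "\<psi> \<in> borel_measurable borel" "bounded (range \<psi>)"
      and M: "prob_space M"
      and V: "\<forall>n\<ge>1. V n \<in> measurable M (hoelder_borel \<beta>) \<and>
             (AE \<omega> in M. V n \<omega> \<in> B) \<and> (AE \<omega> in M. \<forall>x. V n \<omega> x \<ge> 0)"
      and d: "\<forall>n\<ge>1. d n > 0" and \<epsilon>: "0 < \<epsilon>" "\<epsilon> \<le> 1"
      and \<xi>: "\<forall>n\<ge>1. \<forall>j\<in>{1..n}. \<xi> n j \<in> borel_measurable M \<and> \<xi>' n j \<in> borel_measurable M"
      and n: "1 \<le> n"
    let ?v = "SUP m\<in>{1..}. ess_sup_norm M (V m)"
    let ?P = "SUP a\<in>X. ennreal (P_exceed M \<epsilon> K \<psi> n (d n) (\<xi> n) (\<xi>' n) a)"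
    let ?Q = "SUP a\<in>X. ennreal (Q_deviate M \<epsilon> K \<psi> n (d n) (\<xi> n) a)"
    have v: "AE \<omega> in M. sup_norm (V n \<omega>) \<le> ?v"
      using esssup_AE[of "\<lambda>\<omega>. sup_norm (V n \<omega>)" M]
    proof eventually_elim
      case (elim \<omega>)
      also have "esssup M (\<lambda>\<omega>. sup_norm (V n \<omega>)) \<le> ?v"
        using n by (intro SUP_upper2[of n]) (auto simp: ess_sup_norm_def)
      finally show ?case .
    qed
    have dn: "d n > 0" using d n by simp
    have general: "ennreal (E_diff M \<epsilon> \<psi> n (V n) (\<xi> n) (\<xi>' n))
        \<le> ennreal (2 + \<epsilon>) * (ennreal (1 / d n ^ CARD('d)) * sup_norm K ^ CARD('d) * sup_norm \<psi>)
            * (?v * p * emeasure lborel X + tail_mass M X (V n))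
          + ennreal (2 + \<epsilon>) * (\<delta> * sup_norm \<psi>)"
      if "AE \<omega> in M. \<forall>x. ennreal \<bar>V n \<omega> x - convolve (mollifier K (d n)) (V n \<omega>) x\<bar> \<le> \<delta>"
        "\<And>a. a \<in> X \<Longrightarrow> ennreal (P_exceed M \<epsilon> K \<psi> n (d n) (\<xi> n) (\<xi>' n) a) \<le> p" for \<delta> p
      by (rule E_diff_le[OF M kernel_of_orderD(2)[OF K] B X \<psi> _ _ _ dn _ n _ _ that(1) v that(2)])
         (use V \<xi> n \<epsilon> in auto)
    have err: "AE \<omega> in M. \<forall>x. ennreal \<bar>V n \<omega> x - convolve (mollifier K (d n)) (V n \<omega>) x\<bar>
        \<le> smoothing_error \<beta> B K * ennreal (d n powr \<beta>)"
    proof -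
      have "AE \<omega> in M. V n \<omega> \<in> B" using V n by simp
      then show ?thesis by eventually_elim (simp add: smoothing_error_upper dn)
    qed
    have P: "ennreal (P_exceed M \<epsilon> K \<psi> n (d n) (\<xi> n) (\<xi>' n) a) \<le> ?P" if "a \<in> X" for a
      using that by (rule SUP_upper)
    show "ereal (E_diff M \<epsilon> \<psi> n (V n) (\<xi> n) (\<xi>' n)) \<le> enn2ereal (
        CX X K * ?v * sup_norm \<psi> * ennreal (1 / d n ^ CARD('d)) * ?P
        + CB \<beta> B K * sup_norm \<psi> * ennreal (d n powr \<beta>)
        + ennreal (2 + \<epsilon>) * ennreal (1 / d n ^ CARD('d)) * sup_norm K ^ CARD('d) * sup_norm \<psi> * tail_mass M X (V n))"
      using bound[OF \<epsilon>(2) general[OF err P]] by (simp add: CB_def mult_ac)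
    assume law: "\<forall>n\<ge>1. same_law M n (\<xi> n) (\<xi>' n)"
    have PQ: "ennreal (P_exceed M \<epsilon> K \<psi> n (d n) (\<xi> n) (\<xi>' n) a) \<le> 2 * ?Q" if "a \<in> X" for a
    proof -
      have "P_exceed M \<epsilon> K \<psi> n (d n) (\<xi> n) (\<xi>' n) a \<le> 2 * Q_deviate M \<epsilon> K \<psi> n (d n) (\<xi> n) a"
        using law n \<xi> by (intro P_exceed_le_2_Q_deviate M kernel_of_orderD(1)[OF K] \<psi> \<epsilon>) auto
      then have "ennreal (P_exceed M \<epsilon> K \<psi> n (d n) (\<xi> n) (\<xi>' n) a) \<le> 2 * ennreal (Q_deviate M \<epsilon> K \<psi> n (d n) (\<xi> n) a)"
        using ennreal_leI by (fastforce simp: ennreal_mult')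
      also have "\<dots> \<le> 2 * ?Q" using that by (intro mult_left_mono SUP_upper) auto
      finally show ?thesis .
    qed
    show "ereal (E_diff M \<epsilon> \<psi> n (V n) (\<xi> n) (\<xi>' n)) \<le> enn2ereal (
        2 * CX X K * ?v * sup_norm \<psi> * ennreal (1 / d n ^ CARD('d)) * ?Q
        + CB \<beta> B K * sup_norm \<psi> * ennreal (d n powr \<beta>)
        + ennreal (2 + \<epsilon>) * ennreal (1 / d n ^ CARD('d)) * sup_norm K ^ CARD('d) * sup_norm \<psi> * tail_mass M X (V n))"
      using bound[OF \<epsilon>(2) general[OF err PQ]] by (simp add: CB_def mult_ac)
    \<comment> \<open>Now the remainder vanishes almost surely, so the general estimate applies with
      \<open>\<delta> = 0\<close> and the middle term disappears.\<close>
    assume "\<forall>n\<ge>1. AE \<omega> in M. convolve (mollifier K (d n)) (V n \<omega>) = V n \<omega>"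
    then have "AE \<omega> in M. convolve (mollifier K (d n)) (V n \<omega>) = V n \<omega>" using n by simp
    then have "AE \<omega> in M. \<forall>x. ennreal \<bar>V n \<omega> x - convolve (mollifier K (d n)) (V n \<omega>) x\<bar> \<le> 0"
      by eventually_elim simp
    from bound[OF \<epsilon>(2) general[OF this PQ]]
    show "ereal (E_diff M \<epsilon> \<psi> n (V n) (\<xi> n) (\<xi>' n)) \<le> enn2ereal (
        2 * CX X K * ?v * sup_norm \<psi> * ennreal (1 / d n ^ CARD('d)) * ?Q
        + ennreal (2 + \<epsilon>) * ennreal (1 / d n ^ CARD('d)) * sup_norm K ^ CARD('d) * sup_norm \<psi> * tail_mass M X (V n))"
      by (simp add: mult_ac)
  qed
qed

end
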